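(* Let $p\ge 2$, $s\in(0,1)$ and let $v\in L^\infty(\mathbb{R}^n\times(-2,0])$ be a viscosity solution of $$|v_t|^{p-2}v_t+(-\Delta_p)^s v=0\quad\text{in } B_2\times(-2,0].$$ Then $v$ is Hölder continuous in $B_1\times(-1,0]$, and in particular there exist $\alpha$ and $C$ depending on $p$ and $s$ such that $$\|v\|_{C^\alpha(B_1\times(-1,0])}\le C\,\|v\|_{L^\infty(\mathbb{R}^n\times(-2,0])}.$$
   Context: The dimension $n$ is fixed; $B_r(x_0)\subset\mathbb{R}^n$ is the open ball of radius $r$ centered at $x_0$ and $B_r=B_r(0)$. The fractional $p$-Laplacian acts in the space variable for each fixed $t$: $$(-\Delta_p)^s u(x,t)=2\,\mathrm{P.V.}\int_{\mathbb{R}^n}\frac{|u(x,t)-u(x+y,t)|^{p-2}(u(x,t)-u(x+y,t))}{|y|^{n+sp}}\,dy,$$ where P.V. denotes the principal value (it is well defined at points near which the bounded function $u(\cdot,t)$ is $C^2$, when $p\ge2$). The space $C^{2,1}_{x,t}(D\times J)$ consists of functions that are $C^2$ in the spatial variables and $C^1$ in $t$ on $D\times J$. Viscosity solutions. Let $U\subset\mathbb{R}^n$ be open and $I\subset\mathbb{R}$ an interval. A function $v\in L^\infty(\mathbb{R}^n\times I)$ which is upper semicontinuous in $U\times I$ is a viscosity subsolution of $|v_t|^{p-2}v_t+(-\Delta_p)^s v\le C$ in $U\times I$ if the following holds: whenever $(x_0,t_0)\in U\times I$ and $\phi\in C^{2,1}_{x,t}(B_r(x_0)\times(t_0-r,t_0+r))$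 for some $r>0$ satisfy $\phi(x_0,t_0)=v(x_0,t_0)$ and $\phi(x,t)\ge v(x,t)$ for $(x,t)\in B_r(x_0)\times(t_0-r,t_0+r)$, then $$|\phi_t(x_0,t_0)|^{p-2}\phi_t(x_0,t_0)+(-\Delta_p)^s\phi^r(x_0,t_0)\le C,$$ where $\phi^r=\phi$ in $B_r(x_0)\times(t_0-r,t_0+r)$ and $\phi^r=v$ in $(\mathbb{R}^n\setminus B_r(x_0))\times(t_0-r,t_0+r)$. Supersolutions are defined similarly (lower semicontinuity, touching from below, reversed inequality). A solution (of the equation with right-hand side $0$) is a function that is both a sub- and a supersolution with $C=0$. For $I=(-2,0]$, which contains its right endpoint, the time neighbourhoods $(t_0-r,t_0+r)$ are intersected with $I$. *)

theory Defs
  imports "HOL-Analysis.Analysis" "HOL-Probability.Essential_Supremum"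
begin

text \<open>Functions on space-time have type \<open>'a \<times> real \<Rightarrow> real\<close>, where \<open>'a\<close> is Euclidean space; only their
  values on \<open>UNIV \<times> I\<close> matter, where \<open>I\<close> is the time interval.\<close>

subsection \<open>The fractional p-Laplacian\<close>

text \<open>The odd power \<open>\<bar>a\<bar>\<^bsup>p-2\<^esup> a\<close>. Since \<open>0 powr 0 = 0\<close>, it is worth noting that the factor \<open>a\<close> gives the
  right value \<open>0\<close> at \<open>a = 0\<close> also when \<open>p = 2\<close>.\<close>

definition odd_powr :: "real \<Rightarrow> real \<Rightarrow> real" where
  "odd_powr p a = \<bar>a\<bar> powr (p - 2) * a"

text \<open>The Lebesgue integral with values in \<open>[-\<infinity>, \<infinity>]\<close>. A test function need not be bounded near the boundary of
  the ball on which it touches, so the integrals below can be \<open>-\<infinity>\<close> (touching from above) or \<open>\<infinity>\<close> (from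
  below); the Bochner integral would have the value \<open>0\<close> there. In neither situation are both parts
  infinite.\<close>

definition extended_integral :: "'b measure \<Rightarrow> ('b \<Rightarrow> real) \<Rightarrow> ereal" where
  "extended_integral M f =
     enn2ereal (\<integral>\<^sup>+ y. ennreal (f y) \<partial>M) - enn2ereal (\<integral>\<^sup>+ y. ennreal (- f y) \<partial>M)"

lemma extended_integral_eq:
  assumes "integrable M f"
  shows "extended_integral M f = ereal (integral\<^sup>L M f)"
proof -
  have "(\<integral>\<^sup>+ y. ennreal (f y) \<partial>M) \<noteq> \<infinity>" "(\<integral>\<^sup>+ y. ennreal (- f y) \<partial>M) \<noteq> \<infinity>"
    using assms by (simp_all add: real_integrable_def)
  then show ?thesis
    unfolding extended_integral_def real_lebesgue_integral_def[OF assms]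
    by (cases "(\<integral>\<^sup>+ y. ennreal (f y) \<partial>M)"; cases "(\<integral>\<^sup>+ y. ennreal (- f y) \<partial>M)")
       (auto simp: enn2ereal_ennreal)
qed

definition fractional_p_laplacian ::
  "real \<Rightarrow> real \<Rightarrow> ('a::euclidean_space \<times> real \<Rightarrow> real) \<Rightarrow> 'a \<times> real \<Rightarrow> ereal" where
  "fractional_p_laplacian p s u = (\<lambda>(x, t).
     2 * Lim (at_right 0) (\<lambda>\<epsilon>. extended_integral (lebesgue_on {y. \<epsilon> < norm y})
           (\<lambda>y. odd_powr p (u (x, t) - u (x + y, t)) / norm y powr (real DIM('a) + s * p))))"

subsection \<open>Function spaces\<close>

text \<open>\<open>\<phi> \<in> C\<^bsup>2,1\<^esup>(D \<times> J)\<close> with time derivative \<open>\<phi>\<^sub>t\<close>, for open \<open>D\<close>: the first two space derivatives and the time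
  derivative exist and are jointly continuous. The time derivative is taken within \<open>J\<close>, so that it
  is one-sided at an end point which belongs to \<open>J\<close>.\<close>

definition C21_on ::
  "'a::euclidean_space set \<Rightarrow> real set \<Rightarrow> ('a \<times> real \<Rightarrow> real) \<Rightarrow> ('a \<times> real \<Rightarrow> real) \<Rightarrow> bool" where
  "C21_on D J \<phi> \<phi>\<^sub>t \<longleftrightarrow>
     (\<exists>(D1 :: 'a \<times> real \<Rightarrow> ('a \<Rightarrow>\<^sub>L real)) (D2 :: 'a \<times> real \<Rightarrow> ('a \<Rightarrow>\<^sub>L ('a \<Rightarrow>\<^sub>L real))).
        (\<forall>x\<in>D. \<forall>t\<in>J.
           ((\<lambda>z. \<phi> (z, t)) has_derivative blinfun_apply (D1 (x, t))) (at x) \<and>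
           ((\<lambda>z. D1 (z, t)) has_derivative blinfun_apply (D2 (x, t))) (at x) \<and>
           ((\<lambda>\<tau>. \<phi> (x, \<tau>)) has_real_derivative \<phi>\<^sub>t (x, t)) (at t within J)) \<and>
        continuous_on (D \<times> J) \<phi> \<and> continuous_on (D \<times> J) D1 \<and>
        continuous_on (D \<times> J) D2 \<and> continuous_on (D \<times> J) \<phi>\<^sub>t)"

definition usc_on :: "'b::topological_space set \<Rightarrow> ('b \<Rightarrow> real) \<Rightarrow> bool" where
  "usc_on S f \<longleftrightarrow> (\<forall>z\<in>S. \<forall>a > f z. \<forall>\<^sub>F w in at z within S. f w < a)"

definition lsc_on :: "'b::topological_space set \<Rightarrow> ('b \<Rightarrow> real) \<Rightarrow> bool" where
  "lsc_on S f \<longleftrightarrow> (\<forall>z\<in>S. \<forall>a < f z. \<forall>\<^sub>F w in at z within S. a < f w)"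

text \<open>The space \<open>L\<^bsup>\<infinity>\<^esup>(\<real>\<^bsup>n\<^esup> \<times> I)\<close>. In the viscosity setting the equation is tested, and the nonlocal operator
  evaluated, on every time slice, so that changing \<open>v\<close> on a null set of times is not harmless. The
  norm is therefore the supremum over all times of the essential suprema in space.\<close>

definition Linf_norm :: "real set \<Rightarrow> ('a::euclidean_space \<times> real \<Rightarrow> real) \<Rightarrow> ennreal" where
  "Linf_norm I v = (SUP t\<in>I. esssup lebesgue (\<lambda>x. ennreal \<bar>v (x, t)\<bar>))"

definition Linf :: "real set \<Rightarrow> ('a::euclidean_space \<times> real \<Rightarrow> real) set" where
  "Linf I = {v. v \<in> borel_measurable (lebesgue_on (UNIV \<times> I)) \<and>
     (\<forall>t\<in>I. (\<lambda>x. v (x, t)) \<in> borel_measurable lebesgue) \<and> Linf_norm I v < \<infinity>}"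

definition holder_norm :: "real \<Rightarrow> 'b::metric_space set \<Rightarrow> ('b \<Rightarrow> real) \<Rightarrow> ennreal" where
  "holder_norm \<alpha> S f =
     (SUP z\<in>S. ennreal \<bar>f z\<bar>) +
     (SUP (z, w)\<in>{(z, w). z \<in> S \<and> w \<in> S \<and> z \<noteq> w}. ennreal (\<bar>f z - f w\<bar> / dist z w powr \<alpha>))"

subsection \<open>Viscosity solutions\<close>

definition time_nbhd :: "real set \<Rightarrow> real \<Rightarrow> real \<Rightarrow> real set" where
  "time_nbhd I t0 r = {t0 - r <..< t0 + r} \<inter> I"

text \<open>The function \<open>\<phi>\<^bsup>r\<^esup>\<close>.\<close>

definition patch ::
  "('a::metric_space \<times> real \<Rightarrow> real) \<Rightarrow> ('a \<times> real \<Rightarrow> real) \<Rightarrow> real set \<Rightarrow> 'a \<times> real \<Rightarrow> real \<Rightarrow>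
   'a \<times> real \<Rightarrow> real" where
  "patch \<phi> v I = (\<lambda>(x0, t0) r z. if z \<in> ball x0 r \<times> time_nbhd I t0 r then \<phi> z else v z)"

definition viscosity_subsolution ::
  "real \<Rightarrow> real \<Rightarrow> real \<Rightarrow> 'a::euclidean_space set \<Rightarrow> real set \<Rightarrow> ('a \<times> real \<Rightarrow> real) \<Rightarrow> bool" where
  "viscosity_subsolution p s C U I v \<longleftrightarrow>
     v \<in> Linf I \<and> usc_on (U \<times> I) v \<and>
     (\<forall>x0\<in>U. \<forall>t0\<in>I. \<forall>r>0. \<forall>\<phi> \<phi>\<^sub>t.
        C21_on (ball x0 r) (time_nbhd I t0 r) \<phi> \<phi>\<^sub>t \<and> \<phi> (x0, t0) = v (x0, t0) \<and>
        (\<forall>z \<in> ball x0 r \<times> time_nbhd I t0 r. v z \<le> \<phi> z) \<longrightarrow>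
        ereal (odd_powr p (\<phi>\<^sub>t (x0, t0)))
          + fractional_p_laplacian p s (patch \<phi> v I (x0, t0) r) (x0, t0) \<le> ereal C)"

definition viscosity_supersolution ::
  "real \<Rightarrow> real \<Rightarrow> real \<Rightarrow> 'a::euclidean_space set \<Rightarrow> real set \<Rightarrow> ('a \<times> real \<Rightarrow> real) \<Rightarrow> bool" where
  "viscosity_supersolution p s C U I v \<longleftrightarrow>
     v \<in> Linf I \<and> lsc_on (U \<times> I) v \<and>
     (\<forall>x0\<in>U. \<forall>t0\<in>I. \<forall>r>0. \<forall>\<phi> \<phi>\<^sub>t.
        C21_on (ball x0 r) (time_nbhd I t0 r) \<phi> \<phi>\<^sub>t \<and> \<phi> (x0, t0) = v (x0, t0) \<and>
        (\<forall>z \<in> ball x0 r \<times> time_nbhd I t0 r. \<phi> z \<le> v z) \<longrightarrow>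
        ereal C \<le> ereal (odd_powr p (\<phi>\<^sub>t (x0, t0)))
          + fractional_p_laplacian p s (patch \<phi> v I (x0, t0) r) (x0, t0))"

definition viscosity_solution ::
  "real \<Rightarrow> real \<Rightarrow> 'a::euclidean_space set \<Rightarrow> real set \<Rightarrow> ('a \<times> real \<Rightarrow> real) \<Rightarrow> bool" where
  "viscosity_solution p s U I v \<longleftrightarrow>
     viscosity_subsolution p s 0 U I v \<and> viscosity_supersolution p s 0 U I v"

end

theory Submission
  imports Defs
begin

text \<open>The oscillation of a solution \<open>v\<close> decays geometrically on shrinking cylinders whose time length
  scales like the power \<open>\<beta> = s p / (p - 1)\<close> of the radius, which is the scaling of the equation. This gives
  Hoelder continuity, once one knows that on each cylinder of radius \<open>3 \<rho>\<close> and time length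
  \<open>2 h\<close>, with \<open>h\<close> proportional to \<open>\<rho>\<^sup>\<beta>\<close>, either the supremum or the infimum of \<open>v\<close> improves by a fixed
  fraction of the oscillation on a smaller cylinder (\<open>oscillation_decrease\<close>).

  Let \<open>2 A\<close> be the oscillation and \<open>M\<close> the upper bound. At every time at least half of a fixed cube
  is filled by points where \<open>v\<close> is low, or by points where \<open>v\<close> is high, in the sense of a
  continuous weight; replacing \<open>v\<close> by \<open>-v\<close> if necessary, \<open>v\<close> is low on average over the first half of the
  time interval. Compare \<open>v\<close> with the barrier \<open>M - m t + K \<bar>x - x0\<bar>\<^sup>2\<close>, where
  \<open>m' = A \<rho>\<^bsup>-\<beta>\<^esup> (16 B \<delta> g - 2 B \<delta>)\<close>, \<open>g\<close> is the average weight at time \<open>t\<close>, and \<open>K = A \<delta> / \<rho>\<^sup>2\<close>. If \<open>v\<close> crossed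
  the barrier, a translate of the barrier would touch \<open>v\<close> from above at a point near \<open>x0\<close>. There the nonlocal
  term is bounded below by a positive multiple of \<open>g\<close>, because \<open>v\<close> is high at the contact point and
  low on the cube, minus a constant times \<open>\<delta>\<^bsup>p - 1\<^esup>\<close> due to the curvature of the barrier and to the values of
  \<open>v\<close> far away (\<open>barrier_contact\<close>). For small \<open>\<delta>\<close> the speed \<open>m'\<close> is too small to balance this
  (\<open>barrier_speed\<close>). Hence \<open>v\<close> stays below the barrier. A quadratic barrier works, without any
  analysis at the edge of the support of a cut-off function, because the time interval is
  short compared with the time in which a bump of radius \<open>\<rho>\<close> decays: of the gain collected in the first
  half, at least half is still there at the end (\<open>supremum_decrease\<close>).

  The estimates are carried out directly at scale \<open>\<rho>\<close>, so that solutions never have to be rescaled. The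
  viscosity property enters only through \<open>viscosity_touching\<close>, where the operator is computed for
  functions that are quadratic near the contact point: the sum of the integrand at \<open>y\<close> and \<open>-y\<close> is
  integrable, so that the principal value exists and is real. A solution is both upper
  and lower semicontinuous, hence continuous, which makes the averages continuous in time
  and \<open>m\<close> continuously differentiable.\<close>

section \<open>The odd power\<close>

lemma odd_powr_nonneg: "0 \<le> a \<Longrightarrow> 2 \<le> p \<Longrightarrow> odd_powr p a = a powr (p - 1)"
  using powr_mult_base[of a "p - 2"] unfolding odd_powr_def
  by (simp add: mult.commute algebra_simps)

lemma odd_powr_minus: "odd_powr p (- a) = - odd_powr p a"
  by (simp add: odd_powr_def)

lemma odd_powr_scale:
  assumes "0 < c" "2 \<le> p"
  shows "odd_powr p (c * a) = c powr (p - 1) * odd_powr p a"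
proof -
  have "c powr (p - 1) = c powr (p - 2) * c"
    using assms powr_mult_base[of c "p - 2"] by (simp add: algebra_simps)
  then show ?thesis
    using assms by (simp add: odd_powr_def abs_mult powr_mult)
qed

lemma odd_powr_mono:
  assumes "2 \<le> p" "a \<le> b"
  shows "odd_powr p a \<le> odd_powr p b"
proof -
  have pos: "odd_powr p x \<le> odd_powr p y" if "0 \<le> x" "x \<le> y" for x y
    using that assms by (simp add: odd_powr_nonneg powr_mono2)
  have sgn: "0 \<le> odd_powr p x" if "0 \<le> x" for x
    using that by (simp add: odd_powr_def)
  consider "0 \<le> a" | "a \<le> 0" "0 \<le> b" | "b \<le> 0" by linarith
  then show ?thesis
  proof cases
    case 1 then show ?thesis using pos assms by blast
  next
    case 2
    then show ?thesis using sgn[of b] sgn[of "- a"] by (simp add: odd_powr_minus)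
  next
    case 3
    then show ?thesis using pos[of "- b" "- a"] assms by (simp add: odd_powr_minus)
  qed
qed

lemma abs_odd_powr: "2 \<le> p \<Longrightarrow> \<bar>odd_powr p a\<bar> = \<bar>a\<bar> powr (p - 1)"
  using odd_powr_nonneg[of "\<bar>a\<bar>" p] by (simp add: odd_powr_def abs_mult)

lemma odd_powr_lipschitz:
  assumes p: "2 \<le> p" and a: "\<bar>a\<bar> \<le> M" and b: "\<bar>b\<bar> \<le> M"
  shows "\<bar>odd_powr p a - odd_powr p b\<bar> \<le> (p - 1) * M powr (p - 2) * \<bar>a - b\<bar>"
proof -
  have M: "0 \<le> M" using a by linarith
  have same: "odd_powr p y - odd_powr p x \<le> (p - 1) * M powr (p - 2) * (y - x)"
    if xy: "0 \<le> x" "x \<le> y" "y \<le> M" for x y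
  proof (cases "x = y")
    case False
    then have "x < y" using xy by simp
    moreover have "continuous_on {x..y} (\<lambda>z. z powr (p - 1))"
      using xy p by (intro continuous_on_powr' continuous_intros) auto
    moreover have "((\<lambda>z. z powr (p - 1)) has_real_derivative (p - 1) * z powr (p - 2)) (at z)"
      if "x < z" "z < y" for z
      using that xy has_real_derivative_powr[of z "p - 1"] by (simp add: algebra_simps)
    ultimately obtain z where z: "x < z" "z < y"
      "y powr (p - 1) - x powr (p - 1) = (y - x) * ((p - 1) * z powr (p - 2))"
      using MVT[of x y "\<lambda>z. z powr (p - 1)"] DERIV_unique
      by (metis (no_types, lifting) real_differentiable_def)
    have "z powr (p - 2) \<le> M powr (p - 2)"
      using z xy p by (intro powr_mono2) auto
    then have "(y - x) * ((p - 1) * z powr (p - 2)) \<le> (y - x) * ((p - 1) * M powr (p - 2))"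
      using xy p by (intro mult_left_mono) auto
    then show ?thesis using z xy p by (simp add: odd_powr_nonneg mult_ac)
  qed simp
  have opp: "odd_powr p y - odd_powr p x \<le> (p - 1) * M powr (p - 2) * (y - x)"
    if xy: "x \<le> 0" "0 \<le> y" "y \<le> M" "- x \<le> M" for x y
  proof -
    have "odd_powr p y \<le> (p - 1) * M powr (p - 2) * y"
      using same[of 0 y] xy by (simp add: odd_powr_def)
    moreover have "odd_powr p (- x) \<le> (p - 1) * M powr (p - 2) * (- x)"
      using same[of 0 "- x"] xy by (simp add: odd_powr_def)
    ultimately show ?thesis by (simp add: odd_powr_minus algebra_simps)
  qed
  have main: "odd_powr p y - odd_powr p x \<le> (p - 1) * M powr (p - 2) * (y - x)"
    if xy: "x \<le> y" "\<bar>x\<bar> \<le> M" "\<bar>y\<bar> \<le> M" for x y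
  proof -
    consider "0 \<le> x" | "x \<le> 0" "0 \<le> y" | "y \<le> 0" by linarith
    then show ?thesis
    proof cases
      case 3
      then show ?thesis using same[of "- y" "- x"] xy by (simp add: odd_powr_minus)
    qed (use same[of x y] opp[of x y] xy in auto)
  qed
  show ?thesis
  proof (cases "a \<le> b")
    case True
    then show ?thesis using main[of a b] odd_powr_mono[OF p True] a b by simp
  next
    case False
    then show ?thesis using main[of b a] odd_powr_mono[OF p, of b a] a b by simp
  qed
qed

lemma borel_measurable_odd_powr [measurable (raw)]:
  assumes "f \<in> borel_measurable M"
  shows "(\<lambda>x. odd_powr p (f x)) \<in> borel_measurable M"
  using assms unfolding odd_powr_def by measurable

section \<open>Powers of the norm near the origin and at infinity\<close>

lemma nn_integral_norm_powr_annulus: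
  assumes r: "0 < r"
  shows "(\<integral>\<^sup>+ (y::'a::euclidean_space). ennreal (norm y powr e) * indicator {y. r \<le> norm y \<and> norm y < 2 * r} y \<partial>lborel)
     \<le> ennreal (unit_ball_vol (real DIM('a)) * 2 ^ DIM('a) * 2 powr \<bar>e\<bar> * r powr (real DIM('a) + e))"
proof -
  have le: "norm y powr e \<le> 2 powr \<bar>e\<bar> * r powr e" if y: "r \<le> norm y" "norm y < 2 * r" for y :: 'a
  proof (cases "0 \<le> e")
    case True
    then have "norm y powr e \<le> (2 * r) powr e" using y r by (intro powr_mono2) auto
    then show ?thesis using True r by (simp add: powr_mult)
  next
    case False
    then have "norm y powr e \<le> r powr e" using y r by (intro powr_mono2') auto
    also have "\<dots> \<le> 2 powr \<bar>e\<bar> * r powr e"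
      using ge_one_powr_ge_zero[of 2 "\<bar>e\<bar>"] by (simp add: mult_le_cancel_right1)
    finally show ?thesis .
  qed
  have "(\<integral>\<^sup>+ (y::'a). ennreal (norm y powr e) * indicator {y. r \<le> norm y \<and> norm y < 2 * r} y \<partial>lborel)
     \<le> (\<integral>\<^sup>+ (y::'a). ennreal (2 powr \<bar>e\<bar> * r powr e) * indicator (ball 0 (2 * r)) y \<partial>lborel)"
    using le by (intro nn_integral_mono) (auto simp: indicator_def intro!: ennreal_leI)
  also have "\<dots> = ennreal (2 powr \<bar>e\<bar> * r powr e) * ennreal (unit_ball_vol (real DIM('a)) * (2 * r) ^ DIM('a))"
    using r by (simp add: nn_integral_cmult_indicator emeasure_ball)
  also have "\<dots> = ennreal (unit_ball_vol (real DIM('a)) * 2 ^ DIM('a) * 2 powr \<bar>e\<bar> * r powr (real DIM('a) + e))"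
    using r by (simp flip: ennreal_mult add: powr_add power_mult_distrib powr_realpow mult_ac)
  finally show ?thesis .
qed

text \<open>A set covered by countably many annuli \<open>r j \<le> \<bar>y\<bar> < 2 r j\<close> whose contributions decay geometrically;
  this serves both for balls about the origin and for their complements.\<close>

lemma nn_integral_norm_powr_dyadic:
  fixes X :: "'a::euclidean_space set"
  assumes r: "\<And>j::nat. 0 < r j" and cover: "\<And>y. y \<in> X \<Longrightarrow> \<exists>j. r j \<le> norm y \<and> norm y < 2 * r j"
    and geo: "\<And>j. r j powr (real DIM('a) + e) = B * \<theta> ^ j" and \<theta>: "0 \<le> \<theta>" "\<theta> < 1" and B: "0 \<le> B"
  shows "(\<integral>\<^sup>+ y. ennreal (norm y powr e) * indicator X y \<partial>lborel)
     \<le> ennreal (unit_ball_vol (real DIM('a)) * 2 ^ DIM('a) * 2 powr \<bar>e\<bar> * B / (1 - \<theta>))"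
proof -
  define D where "D = unit_ball_vol (real DIM('a)) * 2 ^ DIM('a) * 2 powr \<bar>e\<bar>"
  have D: "0 \<le> D" by (simp add: D_def)
  let ?S = "\<lambda>j. {y::'a. r j \<le> norm y \<and> norm y < 2 * r j}"
  let ?f = "\<lambda>j y::'a. ennreal (norm y powr e) * indicator (?S j) y"
  have "(\<integral>\<^sup>+ y. ennreal (norm y powr e) * indicator X y \<partial>lborel) \<le> (\<integral>\<^sup>+ y. (\<Sum>j. ?f j y) \<partial>lborel)"
  proof (rule nn_integral_mono)
    fix y :: 'a
    show "ennreal (norm y powr e) * indicator X y \<le> (\<Sum>j. ?f j y)"
    proof (cases "y \<in> X")
      case True
      then obtain j where "y \<in> ?S j" using cover by blast
      then have "ennreal (norm y powr e) * indicator X y = (\<Sum>i\<in>{j}. ?f i y)" using True by simp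
      also have "\<dots> \<le> (\<Sum>j. ?f j y)" by (rule sum_le_suminf) auto
      finally show ?thesis .
    qed simp
  qed
  also have "\<dots> = (\<Sum>j. \<integral>\<^sup>+ y. ?f j y \<partial>lborel)"
    by (rule nn_integral_suminf) simp
  also have "\<dots> \<le> (\<Sum>j. ennreal (D * B * \<theta> ^ j))"
    using nn_integral_norm_powr_annulus[OF r, where e = e and ?'a = 'a]
    by (intro suminf_le) (auto simp: D_def geo mult_ac)
  also have "\<dots> = ennreal (\<Sum>j. D * B * \<theta> ^ j)"
    using D B \<theta> by (intro suminf_ennreal2 summable_mult summable_geometric) auto
  also have "(\<Sum>j. D * B * \<theta> ^ j) = D * B / (1 - \<theta>)"
    using \<theta> by (simp add: suminf_mult suminf_geometric)
  finally show ?thesis by (simp add: D_def)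
qed

lemma dyadic_power_inbetween:
  assumes "1 \<le> (x::real)"
  shows "\<exists>j::nat. 2 ^ j \<le> x \<and> x < 2 * 2 ^ j"
proof -
  have "\<exists>n::nat. x < 2 ^ n" by (simp add: real_arch_pow)
  then have n: "x < 2 ^ (LEAST n. x < 2 ^ n)" by (rule LeastI_ex)
  obtain j where j: "(LEAST n. x < 2 ^ n) = Suc j"
    using n assms by (cases "LEAST n. x < 2 ^ n") auto
  have "\<not> x < 2 ^ j" using not_less_Least[of j "\<lambda>n. x < 2 ^ n"] j by simp
  then show ?thesis using n j by (intro exI[of _ j]) auto
qed

lemma integrable_from_nn_bound:
  assumes "f \<in> borel_measurable lborel" "\<And>y. 0 \<le> f y" "(\<integral>\<^sup>+ y. ennreal (f y) \<partial>lborel) \<le> ennreal C" "0 \<le> C"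
  shows "integrable lebesgue f \<and> integral\<^sup>L lebesgue f \<le> C"
proof -
  have i: "integrable lborel f"
    using assms by (intro integrableI_nonneg) (auto intro: le_less_trans)
  have "ennreal (integral\<^sup>L lborel f) \<le> ennreal C"
    using nn_integral_eq_integral[OF i] assms by auto
  then have "integral\<^sup>L lborel f \<le> C" using assms by (simp add: ennreal_le_iff)
  then show ?thesis using i assms by (simp add: integrable_completion integral_completion)
qed

lemma two_power_powr: "((2::real) ^ j) powr a = (2 powr a) ^ j"
  by (simp add: powr_realpow[symmetric] powr_powr mult.commute)

text \<open>The constant, up to the power \<open>R\<^sup>a\<close> or \<open>R\<^bsup>-a\<^esup>\<close>, bounding the integral of \<open>\<bar>y\<bar>\<^bsup>a - n\<^esup>\<close> over the ball of
  radius \<open>R\<close> as well as that of \<open>\<bar>y\<bar>\<^bsup>- n - a\<^esup>\<close> over its complement; it is not the exact value.\<close>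

definition annulus_const :: "nat \<Rightarrow> real \<Rightarrow> real" where
  "annulus_const n a = unit_ball_vol (real n) * 2 ^ n * 2 powr (real n + a) / (1 - 2 powr (- a))"

lemma annulus_const_nonneg: "0 < a \<Longrightarrow> 0 \<le> annulus_const n a"
  by (simp add: annulus_const_def powr_less_one less_imp_le)

lemma integral_norm_powr_near:
  assumes a: "0 < a" and R: "0 < R"
  defines "f \<equiv> \<lambda>y::'a::euclidean_space. norm y powr (a - real DIM('a)) * indicator (ball 0 R) y"
  shows "integrable lebesgue f" "integral\<^sup>L lebesgue f \<le> annulus_const DIM('a) a * R powr a"
proof -
  let ?e = "a - real DIM('a)"
  let ?r = "\<lambda>j::nat. R / 2 ^ Suc j"
  have geo: "?r j powr (real DIM('a) + ?e) = R powr a * 2 powr (- a) * (2 powr (- a)) ^ j" for j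
  proof -
    have "((2::real) ^ Suc j) powr a = 2 powr a * (2 powr a) ^ j"
      by (simp only: two_power_powr power_Suc[of "2 powr a"])
    then show ?thesis using R by (simp add: powr_divide powr_minus power_inverse field_simps del: power_Suc)
  qed
  have cover: "\<exists>j. ?r j \<le> norm y \<and> norm y < 2 * ?r j" if y: "y \<in> ball 0 R - {0}" for y :: 'a
  proof -
    have n: "0 < norm y" "norm y < R" using y by auto
    obtain i where i: "R / norm y < 2 ^ i" using real_arch_pow[of 2 "R / norm y"] by auto
    define k where "k = (LEAST i. R / norm y \<le> 2 ^ i)"
    have k: "R / norm y \<le> 2 ^ k" unfolding k_def by (rule LeastI[of _ i]) (use i in simp)
    have k0: "k \<noteq> 0" using k n by (intro notI) (simp add: field_simps)
    then obtain j where j: "k = Suc j" using not0_implies_Suc by blast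
    have "\<not> R / norm y \<le> 2 ^ j" using not_less_Least[of j "\<lambda>i. R / norm y \<le> 2 ^ i"] j k_def by simp
    then show ?thesis using k n j by (intro exI[of _ j]) (auto simp: field_simps)
  qed
  have t: "2 powr (- a) < (1::real)" using a by (simp add: powr_less_one)
  have "(\<integral>\<^sup>+ y. ennreal (f y) \<partial>lborel) = (\<integral>\<^sup>+ y. ennreal (norm y powr ?e) * indicator (ball 0 R - {0::'a}) y \<partial>lborel)"
    using R unfolding f_def by (intro nn_integral_cong) (auto simp: indicator_def)
  also have "\<dots> \<le> ennreal (unit_ball_vol (real DIM('a)) * 2 ^ DIM('a) * 2 powr \<bar>?e\<bar> * (R powr a * 2 powr (- a)) / (1 - 2 powr (- a)))"
    by (rule nn_integral_norm_powr_dyadic[OF _ cover geo]) (use R t in auto)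
  also have "\<dots> \<le> ennreal (annulus_const DIM('a) a * R powr a)"
  proof (rule ennreal_leI)
    have "2 powr \<bar>?e\<bar> * 2 powr (- a) \<le> (2::real) powr (real DIM('a) + a)"
      using a by (subst powr_add[symmetric]) (intro powr_mono, auto)
    then have "unit_ball_vol (real DIM('a)) * 2 ^ DIM('a) * R powr a / (1 - 2 powr (- a)) * (2 powr \<bar>?e\<bar> * 2 powr (- a))
        \<le> unit_ball_vol (real DIM('a)) * 2 ^ DIM('a) * R powr a / (1 - 2 powr (- a)) * 2 powr (real DIM('a) + a)"
      using t by (intro mult_left_mono) auto
    then show "unit_ball_vol (real DIM('a)) * 2 ^ DIM('a) * 2 powr \<bar>?e\<bar> * (R powr a * 2 powr (- a)) / (1 - 2 powr (- a))
      \<le> annulus_const DIM('a) a * R powr a"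
      by (simp add: annulus_const_def mult_ac)
  qed
  finally have b: "(\<integral>\<^sup>+ y. ennreal (f y) \<partial>lborel) \<le> ennreal (annulus_const DIM('a) a * R powr a)" .
  have [measurable]: "ball (0::'a) R \<in> sets borel" by simp
  have "f \<in> borel_measurable lborel" unfolding f_def by simp
  from integrable_from_nn_bound[OF this _ b] 
  show "integrable lebesgue f" "integral\<^sup>L lebesgue f \<le> annulus_const DIM('a) a * R powr a"
    using annulus_const_nonneg[OF a] by (auto simp: f_def)
qed

lemma integral_norm_powr_far:
  assumes a: "0 < a" and R: "0 < R"
  defines "f \<equiv> \<lambda>y::'a::euclidean_space. norm y powr (- real DIM('a) - a) * indicator (- ball 0 R) y"
  shows "integrable lebesgue f" "integral\<^sup>L lebesgue f \<le> annulus_const DIM('a) a * R powr (- a)"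
proof -
  let ?e = "- real DIM('a) - a"
  let ?r = "\<lambda>j::nat. R * 2 ^ j"
  have geo: "?r j powr (real DIM('a) + ?e) = R powr (- a) * (2 powr (- a)) ^ j" for j
    using R by (simp add: powr_mult two_power_powr)
  have cover: "\<exists>j. ?r j \<le> norm y \<and> norm y < 2 * ?r j" if y: "y \<in> - ball 0 R" for y :: 'a
  proof -
    have "1 \<le> norm y / R" using y R by auto
    from dyadic_power_inbetween[OF this] show ?thesis using R by (auto simp: field_simps)
  qed
  have t: "2 powr (- a) < (1::real)" using a by (simp add: powr_less_one)
  have "(\<integral>\<^sup>+ y. ennreal (f y) \<partial>lborel) = (\<integral>\<^sup>+ y. ennreal (norm y powr ?e) * indicator (- ball 0 R :: 'a set) y \<partial>lborel)"
    unfolding f_def by (intro nn_integral_cong) (auto simp: indicator_def)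
  also have "\<dots> \<le> ennreal (unit_ball_vol (real DIM('a)) * 2 ^ DIM('a) * 2 powr \<bar>?e\<bar> * R powr (- a) / (1 - 2 powr (- a)))"
    by (rule nn_integral_norm_powr_dyadic[OF _ cover geo]) (use R t in auto)
  also have "\<dots> = ennreal (annulus_const DIM('a) a * R powr (- a))"
    using a by (simp add: annulus_const_def mult_ac add_ac)
  finally have b: "(\<integral>\<^sup>+ y. ennreal (f y) \<partial>lborel) \<le> ennreal (annulus_const DIM('a) a * R powr (- a))" .
  have [measurable]: "ball (0::'a) R \<in> sets borel" by simp
  have "f \<in> borel_measurable lborel" unfolding f_def by simp
  from integrable_from_nn_bound[OF this _ b] 
  show "integrable lebesgue f" "integral\<^sup>L lebesgue f \<le> annulus_const DIM('a) a * R powr (- a)"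
    using annulus_const_nonneg[OF a] by (auto simp: f_def)
qed

section \<open>The principal value\<close>

lemma integral_reflect_lborel:
  fixes f :: "'a::euclidean_space \<Rightarrow> real"
  assumes [measurable]: "f \<in> borel_measurable borel"
  shows "integral\<^sup>L lborel (\<lambda>y. f (- y)) = integral\<^sup>L lborel f"
    and "integrable lborel (\<lambda>y. f (- y)) \<longleftrightarrow> integrable lborel f"
proof -
  have d: "distr lborel borel uminus = (lborel :: 'a measure)"
    by (subst lborel_affine[of "-1" 0], auto simp: density_1)
  have "integral\<^sup>L (distr lborel borel uminus) f = integral\<^sup>L lborel (\<lambda>y. f (- y))"
    by (rule integral_distr) auto
  then show "integral\<^sup>L lborel (\<lambda>y. f (- y)) = integral\<^sup>L lborel f" by (simp add: d)
  have "integrable (distr lborel borel uminus) f \<longleftrightarrow> integrable lborel (\<lambda>y. f (- y))"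
    by (rule integrable_distr_eq) auto
  then show "integrable lborel (\<lambda>y. f (- y)) \<longleftrightarrow> integrable lborel f" by (simp add: d)
qed

text \<open>The integrand of the operator for the quadratic function \<open>z \<mapsto> K \<bar>z\<bar>\<^sup>2\<close> about a point where its
  gradient is \<open>b\<close>.\<close>

definition quadratic_integrand :: "real \<Rightarrow> real \<Rightarrow> real \<Rightarrow> 'a::euclidean_space \<Rightarrow> 'a \<Rightarrow> real" where
  "quadratic_integrand p s K b y =
     odd_powr p (- (b \<bullet> y) - K * (norm y)\<^sup>2) / norm y powr (real DIM('a) + s * p)"

lemma borel_measurable_quadratic_integrand [measurable]:
  "quadratic_integrand p s K b \<in> borel_measurable borel"
  unfolding quadratic_integrand_def by measurable

text \<open>The constant bounding the principal value of the quadratic integrand over a ball, where the powers of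
  \<open>K\<close> and of the radius are split off.\<close>

definition near_const :: "nat \<Rightarrow> real \<Rightarrow> real \<Rightarrow> real" where
  "near_const n p s = (p - 1) * 2 powr (p - 2) * annulus_const n (p - s * p)"

lemma sp_less_p: "2 \<le> p \<Longrightarrow> s < 1 \<Longrightarrow> s * p < (p::real)"
  using mult_strict_right_mono[of s 1 p] by simp

lemma near_const_nonneg: "2 \<le> p \<Longrightarrow> s < 1 \<Longrightarrow> 0 \<le> near_const n p s"
  using sp_less_p by (auto simp: near_const_def intro!: mult_nonneg_nonneg annulus_const_nonneg)

text \<open>The integrand itself is of order \<open>\<bar>y\<bar>\<^bsup>p - 1 - n - sp\<^esup>\<close>, which need not be integrable at the origin;
  the sum of its values at \<open>y\<close> and \<open>-y\<close> is of order \<open>\<bar>y\<bar>\<^bsup>p - n - sp\<^esup>\<close>, which is.\<close>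

lemma quadratic_integrand_symmetrized:
  fixes b :: "'a::euclidean_space"
  assumes p: "2 \<le> p" and K: "0 \<le> K" and R: "0 < R" and b: "norm b \<le> K * R" and y: "norm y < R"
  shows "\<bar>quadratic_integrand p s K b y + quadratic_integrand p s K b (- y)\<bar>
    \<le> 2 * ((p - 1) * 2 powr (p - 2) * K powr (p - 1) * R powr (p - 2)) * norm y powr (p - s * p - real DIM('a))"
proof (cases "y = 0")
  case False
  then have n: "0 < norm y" by simp
  define M where "M = 2 * (K * R * norm y)"
  have \<xi>: "\<bar>b \<bullet> y\<bar> \<le> K * R * norm y"
    using Cauchy_Schwarz_ineq2[of b y] mult_right_mono[OF b, of "norm y"] by simp
  have "K * norm y * norm y \<le> K * norm y * R"
    using K y by (intro mult_left_mono) auto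
  then have \<eta>: "K * (norm y)\<^sup>2 \<le> K * R * norm y" "0 \<le> K * (norm y)\<^sup>2"
    using K by (auto simp: power2_eq_square mult_ac)
  let ?u = "b \<bullet> y - K * (norm y)\<^sup>2" and ?w = "b \<bullet> y + K * (norm y)\<^sup>2"
  have "\<bar>odd_powr p ?u - odd_powr p ?w\<bar> \<le> (p - 1) * M powr (p - 2) * \<bar>?u - ?w\<bar>"
    by (rule odd_powr_lipschitz[OF p]) (use \<xi> \<eta> in \<open>auto simp: M_def\<close>)
  also have "\<bar>?u - ?w\<bar> = 2 * K * (norm y)\<^sup>2" using \<eta> by simp
  also have "M powr (p - 2) = 2 powr (p - 2) * K powr (p - 2) * R powr (p - 2) * norm y powr (p - 2)"
    using K R by (simp add: M_def powr_mult)
  also have "(p - 1) * (2 powr (p - 2) * K powr (p - 2) * R powr (p - 2) * norm y powr (p - 2)) * (2 * K * (norm y)\<^sup>2)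
     = 2 * ((p - 1) * 2 powr (p - 2) * (K * K powr (p - 2)) * R powr (p - 2)) * (norm y powr (p - 2) * (norm y)\<^sup>2)"
    by (simp add: mult_ac)
  also have "K * K powr (p - 2) = K powr (p - 1)"
    using K powr_mult_base[of K "p - 2"] by (simp add: algebra_simps)
  also have "norm y powr (p - 2) * (norm y)\<^sup>2 = norm y powr p"
    using n powr_add[of "norm y" "p - 2" 2] by simp
  finally have 1: "\<bar>odd_powr p ?u - odd_powr p ?w\<bar>
      \<le> 2 * ((p - 1) * 2 powr (p - 2) * K powr (p - 1) * R powr (p - 2)) * norm y powr p" .
  have "odd_powr p (- (b \<bullet> y) - K * (norm y)\<^sup>2) = - odd_powr p ?w"
    using odd_powr_minus[of p ?w] by simp
  then have "quadratic_integrand p s K b y + quadratic_integrand p s K b (- y)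
      = (odd_powr p ?u - odd_powr p ?w) / norm y powr (real DIM('a) + s * p)"
    unfolding quadratic_integrand_def by (simp add: diff_divide_distrib)
  then have "\<bar>quadratic_integrand p s K b y + quadratic_integrand p s K b (- y)\<bar>
      = \<bar>odd_powr p ?u - odd_powr p ?w\<bar> / norm y powr (real DIM('a) + s * p)" by simp
  also have "\<dots> \<le> 2 * ((p - 1) * 2 powr (p - 2) * K powr (p - 1) * R powr (p - 2)) * norm y powr p / norm y powr (real DIM('a) + s * p)"
    by (rule divide_right_mono[OF 1]) simp
  also have "\<dots> = 2 * ((p - 1) * 2 powr (p - 2) * K powr (p - 1) * R powr (p - 2)) * norm y powr (p - s * p - real DIM('a))"
    by (simp add: powr_diff powr_add)
  finally show ?thesis .
qed (simp add: quadratic_integrand_def odd_powr_def)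

lemma quadratic_principal_value:
  fixes b :: "'a::euclidean_space"
  assumes p: "2 \<le> p" and s: "0 < s" "s < 1" and K: "0 \<le> K" and R: "0 < R" and b: "norm b \<le> K * R"
  defines "q \<equiv> \<lambda>\<epsilon> y. quadratic_integrand p s K b y * indicator {y. \<epsilon> < norm y \<and> norm y < R} y"
  obtains N where "\<And>\<epsilon>. 0 < \<epsilon> \<Longrightarrow> integrable lebesgue (q \<epsilon>)"
    "((\<lambda>\<epsilon>. integral\<^sup>L lebesgue (q \<epsilon>)) \<longlongrightarrow> N) (at_right 0)"
    "\<bar>N\<bar> \<le> near_const DIM('a) p s * K powr (p - 1) * R powr (2 * p - 2 - s * p)"
proof -
  let ?Q = "quadratic_integrand p s K b"
  define C where "C = (p - 1) * 2 powr (p - 2) * K powr (p - 1) * R powr (p - 2)"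
  define S where "S \<epsilon> y = (?Q y + ?Q (- y)) / 2 * indicator {y. \<epsilon> < norm y \<and> norm y < R} y" for \<epsilon> y
  define W where "W = (\<lambda>y::'a. C * (norm y powr (p - s * p - real DIM('a)) * indicator (ball 0 R) y))"
  have a: "0 < p - s * p" using sp_less_p[OF p] s by simp
  have C: "0 \<le> C" using p by (simp add: C_def)
  have qm [measurable]: "q \<epsilon> \<in> borel_measurable borel" for \<epsilon> unfolding q_def by measurable
  have Sm [measurable]: "S \<epsilon> \<in> borel_measurable borel" for \<epsilon> unfolding S_def by measurable
  have Wi: "integrable lebesgue W" unfolding W_def
    using integral_norm_powr_near(1)[OF a R] by (rule integrable_mult_right)
  have Wl: "integral\<^sup>L lebesgue W \<le> C * (annulus_const DIM('a) (p - s * p) * R powr (p - s * p))"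
    unfolding W_def using integral_norm_powr_near(2)[OF a R, where ?'a = 'a] C
    by (simp add: mult_left_mono)
  have SW: "\<bar>S \<epsilon> y\<bar> \<le> W y" for \<epsilon> y
    using quadratic_integrand_symmetrized[OF p K R b, of y s] C
    by (auto simp: S_def W_def C_def indicator_def)
  have qi: "integrable lborel (q \<epsilon>)" if \<epsilon>: "0 < \<epsilon>" for \<epsilon>
  proof (rule integrableI_bounded_set[where A = "ball 0 R" and B = "(2 * (K * R * R)) powr (p - 1) / \<epsilon> powr (real DIM('a) + s * p)"])
    show "emeasure lborel (ball (0::'a) R) < \<infinity>" using R by (simp add: emeasure_ball)
    have "norm (q \<epsilon> y) \<le> (2 * (K * R * R)) powr (p - 1) / \<epsilon> powr (real DIM('a) + s * p)" for y
    proof (cases "\<epsilon> < norm y \<and> norm y < R")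
      case True
      have "\<bar>b \<bullet> y\<bar> \<le> K * R * R"
        using Cauchy_Schwarz_ineq2[of b y] mult_mono[OF b, of "norm y" R] True K R by simp
      moreover have "K * (norm y)\<^sup>2 \<le> K * R * R" "0 \<le> K * (norm y)\<^sup>2"
        using True K R mult_mono[of "norm y" R "norm y" R]
        by (auto simp: power2_eq_square mult.assoc intro!: mult_left_mono)
      ultimately have "\<bar>- (b \<bullet> y) - K * (norm y)\<^sup>2\<bar> powr (p - 1) \<le> (2 * (K * R * R)) powr (p - 1)"
        using p by (intro powr_mono2) auto
      moreover have "\<epsilon> powr (real DIM('a) + s * p) \<le> norm y powr (real DIM('a) + s * p)"
        using True \<epsilon> s p by (intro powr_mono2) auto
      moreover have "norm (q \<epsilon> y) = \<bar>- (b \<bullet> y) - K * (norm y)\<^sup>2\<bar> powr (p - 1) / norm y powr (real DIM('a) + s * p)"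
        using True p by (simp add: q_def quadratic_integrand_def abs_odd_powr)
      ultimately show ?thesis using \<epsilon> by (simp add: frac_le)
    qed (simp add: q_def)
    then show "AE y in lborel. y \<in> ball 0 R \<longrightarrow> norm (q \<epsilon> y) \<le> (2 * (K * R * R)) powr (p - 1) / \<epsilon> powr (real DIM('a) + s * p)"
      by simp
  qed (auto simp: q_def)
  have qS: "integral\<^sup>L lebesgue (q \<epsilon>) = integral\<^sup>L lebesgue (S \<epsilon>)" if \<epsilon>: "0 < \<epsilon>" for \<epsilon>
  proof -
    have "integral\<^sup>L lborel (S \<epsilon>) = integral\<^sup>L lborel (\<lambda>y. (q \<epsilon> y + q \<epsilon> (- y)) / 2)"
      by (rule Bochner_Integration.integral_cong) (auto simp: S_def q_def indicator_def)
    also have "\<dots> = (integral\<^sup>L lborel (q \<epsilon>) + integral\<^sup>L lborel (\<lambda>y. q \<epsilon> (- y))) / 2"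
      using qi[OF \<epsilon>] integral_reflect_lborel(2)[of "q \<epsilon>"] by simp
    also have "\<dots> = integral\<^sup>L lborel (q \<epsilon>)"
      using integral_reflect_lborel(1)[of "q \<epsilon>"] by simp
    finally show ?thesis by (simp add: integral_completion)
  qed
  have lim: "((\<lambda>t. integral\<^sup>L lebesgue (S (inverse t))) \<longlongrightarrow> integral\<^sup>L lebesgue (S 0)) at_top"
  proof (rule integral_dominated_convergence_at_top[OF _ _ Wi])
    show "\<forall>\<^sub>F i in at_top. AE x in lebesgue. norm (S (inverse i) x) \<le> W x" using SW by simp
    have "((\<lambda>i. S (inverse i) y) \<longlongrightarrow> S 0 y) at_top" for y
    proof (cases "y = 0")
      case False
      have "\<forall>\<^sub>F i in at_top. inverse (norm y) < i" by (rule eventually_gt_at_top)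
      then have "\<forall>\<^sub>F i in at_top. S (inverse i) y = S 0 y"
      proof eventually_elim
        case (elim i)
        moreover have "0 < inverse (norm y)" using False by simp
        ultimately have "inverse i < norm y" using False by (metis inverse_inverse_eq less_imp_inverse_less)
        then show ?case using False by (simp add: S_def indicator_def)
      qed
      then show ?thesis by (rule tendsto_eventually)
    next
      case True
      have "\<forall>\<^sub>F i::real in at_top. 0 < i" by (rule eventually_gt_at_top)
      then have "\<forall>\<^sub>F i in at_top. S (inverse i) y = S 0 y"
        by eventually_elim (use True in \<open>simp add: S_def indicator_def\<close>)
      then show ?thesis by (rule tendsto_eventually)
    qed
    then show "AE x in lebesgue. ((\<lambda>i. S (inverse i) x) \<longlongrightarrow> S 0 x) at_top" by simp
  qed (auto intro: measurable_completion)
  show thesis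
  proof
    show "integrable lebesgue (q \<epsilon>)" if "0 < \<epsilon>" for \<epsilon>
      using qi[OF that] by (simp add: integrable_completion)
    have "((\<lambda>\<epsilon>. integral\<^sup>L lebesgue (S \<epsilon>)) \<longlongrightarrow> integral\<^sup>L lebesgue (S 0)) (at_right 0)"
      using lim by (simp add: filterlim_at_right_to_top)
    then show "((\<lambda>\<epsilon>. integral\<^sup>L lebesgue (q \<epsilon>)) \<longlongrightarrow> integral\<^sup>L lebesgue (S 0)) (at_right 0)"
      by (rule Lim_transform_eventually) (auto simp: eventually_at_right_less qS intro: eventually_mono[OF eventually_at_right_less])
    have "\<bar>integral\<^sup>L lebesgue (S 0)\<bar> \<le> integral\<^sup>L lebesgue W"
      using SW by (intro integral_abs_bound_integral[OF _ Wi])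
        (auto intro!: Bochner_Integration.integrable_bound[OF Wi] measurable_completion AE_I2 order_trans[OF SW])
    also note Wl
    also have "C * (annulus_const DIM('a) (p - s * p) * R powr (p - s * p))
        = near_const DIM('a) p s * K powr (p - 1) * (R powr (p - 2) * R powr (p - s * p))"
      by (simp add: C_def near_const_def mult_ac)
    also have "R powr (p - 2) * R powr (p - s * p) = R powr (2 * p - 2 - s * p)"
      by (subst powr_add[symmetric]) (simp add: algebra_simps)
    finally show "\<bar>integral\<^sup>L lebesgue (S 0)\<bar> \<le> near_const DIM('a) p s * K powr (p - 1) * R powr (2 * p - 2 - s * p)" .
  qed
qed

text \<open>The operator is evaluated by splitting its integrand into a part \<open>H\<close> vanishing near the origin and
  a part supported in a ball whose principal value \<open>N\<close> is known.\<close>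

lemma fractional_p_laplacian_eq:
  fixes U :: "'a::euclidean_space \<times> real \<Rightarrow> real"
  assumes H: "integrable lebesgue H" and H0: "\<And>y. norm y < r \<Longrightarrow> H y = 0" and r: "0 < r"
    and q: "\<And>\<epsilon>. 0 < \<epsilon> \<Longrightarrow> integrable lebesgue (\<lambda>y. q y * indicator {y. \<epsilon> < norm y \<and> norm y < R} y)"
    and N: "((\<lambda>\<epsilon>. LINT y|lebesgue. q y * indicator {y. \<epsilon> < norm y \<and> norm y < R} y) \<longlongrightarrow> N) (at_right 0)"
    and eq: "\<And>y. y \<noteq> 0 \<Longrightarrow> odd_powr p (U (x, t) - U (x + y, t)) / norm y powr (real DIM('a) + s * p)
        = H y + q y * indicator (ball 0 R) y"
  shows "fractional_p_laplacian p s U (x, t) = ereal (2 * (N + integral\<^sup>L lebesgue H))"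
proof -
  let ?F = "\<lambda>y. odd_powr p (U (x, t) - U (x + y, t)) / norm y powr (real DIM('a) + s * p)"
  let ?q = "\<lambda>\<epsilon> y. q y * indicator {y. \<epsilon> < norm y \<and> norm y < R} y"
  let ?E = "\<lambda>\<epsilon>. extended_integral (lebesgue_on {y. \<epsilon> < norm y}) ?F"
  have E: "?E \<epsilon> = ereal (integral\<^sup>L lebesgue (?q \<epsilon>) + integral\<^sup>L lebesgue H)" if \<epsilon>: "0 < \<epsilon>" "\<epsilon> < r" for \<epsilon>
  proof -
    have meas: "{y::'a. \<epsilon> < norm y} \<in> sets lebesgue"
      by (intro sets_completionI_sets) simp
    have "indicator {y. \<epsilon> < norm y} y *\<^sub>R ?F y = ?q \<epsilon> y + H y" for y
    proof (cases "\<epsilon> < norm y")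
      case True
      then have "y \<noteq> 0" using \<epsilon> by auto
      then show ?thesis using True eq[of y] by (simp add: indicator_def)
    next
      case False
      then show ?thesis using \<epsilon> H0[of y] by (simp add: indicator_def)
    qed
    then have "(\<lambda>y. indicator {y. \<epsilon> < norm y} y *\<^sub>R ?F y) = (\<lambda>y. ?q \<epsilon> y + H y)" by blast
    then have "integrable (lebesgue_on {y. \<epsilon> < norm y}) ?F"
      "integral\<^sup>L (lebesgue_on {y. \<epsilon> < norm y}) ?F = integral\<^sup>L lebesgue (?q \<epsilon>) + integral\<^sup>L lebesgue H"
      using meas q[OF \<epsilon>(1)] H by (simp_all add: integrable_restrict_space integral_restrict_space)
    then show ?thesis by (simp add: extended_integral_eq)
  qed
  have "((\<lambda>\<epsilon>. ereal (integral\<^sup>L lebesgue (?q \<epsilon>) + integral\<^sup>L lebesgue H)) \<longlongrightarrow> ereal (N + integral\<^sup>L lebesgue H)) (at_right 0)"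
    by (intro tendsto_ereal tendsto_add N tendsto_const)
  moreover have "\<forall>\<^sub>F \<epsilon> in at_right 0. ereal (integral\<^sup>L lebesgue (?q \<epsilon>) + integral\<^sup>L lebesgue H) = ?E \<epsilon>"
    using eventually_at_right_real[OF r] by eventually_elim (use E in auto)
  ultimately have "(?E \<longlongrightarrow> ereal (N + integral\<^sup>L lebesgue H)) (at_right 0)"
    by (rule Lim_transform_eventually)
  then have "Lim (at_right 0) ?E = ereal (N + integral\<^sup>L lebesgue H)"
    by (intro tendsto_Lim) auto
  then show ?thesis by (simp add: fractional_p_laplacian_def)
qed

section \<open>Testing a viscosity solution with quadratic functions\<close>

lemma has_derivative_shifted_norm_square:
  fixes x0 :: "'a::euclidean_space"
  shows "((\<lambda>z. C + K * (norm (z - x0))\<^sup>2) has_derivative blinfun_apply (blinfun_inner_right ((2 * K) *\<^sub>R (x - x0)))) (at x)"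
  unfolding power2_norm_eq_inner
  by (auto intro!: derivative_eq_intros simp: inner_diff_left inner_diff_right inner_commute algebra_simps)

lemma C21_on_quadratic:
  fixes x0 :: "'a::euclidean_space"
  assumes m: "\<And>t. t \<in> J \<Longrightarrow> (m has_real_derivative m' t) (at t within J)" and m': "continuous_on J m'"
  shows "C21_on D J (\<lambda>(x, t). C + K * (norm (x - x0))\<^sup>2 - m t) (\<lambda>(x, t). - m' t)"
proof -
  define L :: "'a \<Rightarrow>\<^sub>L ('a \<Rightarrow>\<^sub>L real)" where "L = Blinfun (\<lambda>x. blinfun_inner_right ((2 * K) *\<^sub>R x))"
  have bl: "bounded_linear (\<lambda>x::'a. blinfun_inner_right ((2 * K) *\<^sub>R x))"
    by (intro bounded_linear_compose[OF bounded_linear_blinfun_inner_right] bounded_linear_scaleR_right)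
  have L: "blinfun_apply L = (\<lambda>x. blinfun_inner_right ((2 * K) *\<^sub>R x))"
    unfolding L_def by (rule bounded_linear_Blinfun_apply[OF bl])
  have mc: "continuous_on J m"
    using m by (meson DERIV_continuous continuous_on_eq_continuous_within)
  have snd: "continuous_on (D \<times> J) (\<lambda>z. f (snd z))" if "continuous_on J f" for f :: "real \<Rightarrow> real"
    by (rule continuous_on_compose2[OF that continuous_on_snd[OF continuous_on_id]]) auto
  have 1: "((\<lambda>z. C + K * (norm (z - x0))\<^sup>2 - m t) has_derivative blinfun_apply (blinfun_inner_right ((2 * K) *\<^sub>R (x - x0)))) (at x)" for x t
    by (rule has_derivative_eq_rhs[OF has_derivative_diff[OF has_derivative_shifted_norm_square has_derivative_const]]) auto
  have 2: "((\<lambda>z. blinfun_inner_right ((2 * K) *\<^sub>R (z - x0))) has_derivative blinfun_apply L) (at x)" for x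
  proof -
    have "((\<lambda>z. blinfun_apply L (z - x0)) has_derivative blinfun_apply L) (at x)"
      by (auto intro!: derivative_eq_intros)
    then show ?thesis by (simp add: L)
  qed
  have 3: "continuous_on (D \<times> J) (\<lambda>z. blinfun_inner_right ((2 * K) *\<^sub>R (fst z - x0)))"
    by (intro bounded_linear.continuous_on[OF bounded_linear_blinfun_inner_right] continuous_intros)
  have 4: "((\<lambda>\<tau>. C + K * (norm (x - x0))\<^sup>2 - m \<tau>) has_real_derivative - m' t) (at t within J)" if "t \<in> J" for x t
    using DERIV_diff[OF DERIV_const m[OF that]] by simp
  show ?thesis
    unfolding C21_on_def
    by (rule exI[of _ "\<lambda>z. blinfun_inner_right ((2 * K) *\<^sub>R (fst z - x0))"], rule exI[of _ "\<lambda>_. L"])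
       (use 1 2 3 4 in \<open>auto simp: case_prod_beta intro!: continuous_intros snd mc m'\<close>)
qed

lemma Linf_AE_bound:
  assumes "v \<in> Linf I" "t \<in> I"
  shows "AE x in lebesgue. \<bar>v (x, t)\<bar> \<le> enn2real (Linf_norm I v)"
proof -
  have fin: "Linf_norm I v < \<infinity>" using assms by (simp add: Linf_def)
  have ess: "esssup lebesgue (\<lambda>x. ennreal \<bar>v (x, t)\<bar>) \<le> Linf_norm I v"
    unfolding Linf_norm_def by (rule SUP_upper[OF assms(2)])
  have "AE x in lebesgue. ennreal \<bar>v (x, t)\<bar> \<le> esssup lebesgue (\<lambda>x. ennreal \<bar>v (x, t)\<bar>)"
    by (rule esssup_AE)
  then have "AE x in lebesgue. ennreal \<bar>v (x, t)\<bar> \<le> ennreal (enn2real (Linf_norm I v))"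
    by eventually_elim (use ess fin in \<open>auto intro: order_trans\<close>)
  then show ?thesis by (simp add: ennreal_le_iff)
qed

lemma AE_lebesgue_translate:
  fixes a :: "'a::euclidean_space"
  assumes "AE x in lebesgue. P x"
  shows "AE y in lebesgue. P (a + y)"
proof -
  have "AE x in lborel. P x" using assms by (simp add: AE_completion_iff)
  then obtain N where N: "N \<in> null_sets lborel" "{x. \<not> P x} \<subseteq> N"
    by (auto simp: eventually_ae_filter)
  have "{x. x - (- a) \<in> N} \<in> null_sets lborel" by (rule null_sets_translation[OF N(1)])
  then have "AE y in lborel. y \<notin> {x. x - (- a) \<in> N}" by (rule AE_not_in)
  then have "AE y in lborel. P (a + y)" by eventually_elim (use N(2) in \<open>auto simp: add.commute\<close>)
  then show ?thesis by (rule AE_completion)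
qed

lemma borel_measurable_lebesgue_translate:
  fixes f :: "'a::euclidean_space \<Rightarrow> real"
  assumes "f \<in> borel_measurable lebesgue"
  shows "(\<lambda>y. f (a + y)) \<in> borel_measurable lebesgue"
proof (rule borel_measurableI)
  fix S :: "real set" assume "open S"
  then have "f -` S \<inter> space lebesgue \<in> sets lebesgue" using assms by (intro measurable_sets) auto
  then have "(+) (- a) ` (f -` S) \<in> sets lebesgue" by (intro lebesgue_sets_translation) simp
  also have "(+) (- a) ` (f -` S) = (\<lambda>y. f (a + y)) -` S"
    by (auto simp: image_iff intro!: bexI[of _ "a + _"])
  finally show "(\<lambda>y. f (a + y)) -` S \<inter> space lebesgue \<in> sets lebesgue" by simp
qed

text \<open>Apart from continuity and boundedness, the only consequence of the viscosity property that is needed. A quadratic function with an arbitrary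
  \<open>C\<^sup>1\<close> time dependence touches \<open>u = \<plusminus>v\<close> from above in a small cylinder; the sub- and the
  supersolution property of \<open>v\<close> give the same inequality for the two signs. Its nonlocal part is
  stated through any integrable minorant \<open>L\<close> of the integrand, where inside the ball of radius \<open>R\<close>
  the contribution of the quadratic function is subtracted and accounted for by the last term.\<close>

lemma viscosity_touching:
  fixes v :: "'a::euclidean_space \<times> real \<Rightarrow> real"
  assumes p: "2 \<le> p" and s: "0 < s" "s < 1"
    and v: "viscosity_solution p s (ball 0 2) {-2<..0} v"
    and \<sigma>: "\<sigma> = 1 \<or> \<sigma> = -1" and u: "u = (\<lambda>z. \<sigma> * v z)"
    and x1: "x1 \<in> ball 0 2" and K: "0 \<le> K" and R: "0 < R" and x0: "norm (x1 - x0) \<le> R / 2"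
    and r: "0 < r" "r \<le> R" and tr: "{t1 - r<..<t1 + r} \<subseteq> {-2<..<0}"
    and m: "\<And>t. t \<in> {t1 - r<..<t1 + r} \<Longrightarrow> (m has_real_derivative m' t) (at t)"
    and m': "continuous_on {t1 - r<..<t1 + r} m'"
    and touch: "u (x1, t1) = C + K * (norm (x1 - x0))\<^sup>2 - m t1"
    and above: "\<And>x t. x \<in> ball x1 r \<Longrightarrow> t \<in> {t1 - r<..<t1 + r} \<Longrightarrow> u (x, t) \<le> C + K * (norm (x - x0))\<^sup>2 - m t"
    and L: "integrable lebesgue L"
    and L1: "\<And>y. norm y < r \<Longrightarrow> L y \<le> 0"
    and L2: "AE y in lebesgue. r \<le> norm y \<and> norm y < R \<longrightarrow>
       L y \<le> (odd_powr p (u (x1, t1) - u (x1 + y, t1))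
          - odd_powr p (K * (norm (x1 - x0))\<^sup>2 - K * (norm (x1 + y - x0))\<^sup>2)) / norm y powr (real DIM('a) + s * p)"
    and L3: "AE y in lebesgue. R \<le> norm y \<longrightarrow>
       L y \<le> odd_powr p (u (x1, t1) - u (x1 + y, t1)) / norm y powr (real DIM('a) + s * p)"
  shows "2 * integral\<^sup>L lebesgue L \<le> odd_powr p (m' t1)
     + 2 * (near_const DIM('a) p s * K powr (p - 1) * R powr (2 * p - 2 - s * p))"
proof -
  let ?I = "{-2<..0::real}"
  let ?k = "\<lambda>y::'a. norm y powr (real DIM('a) + s * p)"
  define b where "b = (2 * K) *\<^sub>R (x1 - x0)"
  define \<phi> where "\<phi> = (\<lambda>(x, t). C + K * (norm (x - x0))\<^sup>2 - m t)"
  have \<sigma>\<sigma>: "\<sigma> * \<sigma> = 1" using \<sigma> by auto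
  have "t1 \<in> {t1 - r<..<t1 + r}" using r by simp
  then have t1: "t1 \<in> {-2<..<0}" using tr by blast
  have nb: "time_nbhd ?I t1 r = {t1 - r<..<t1 + r}" using tr by (force simp: time_nbhd_def)
  have sub: "viscosity_subsolution p s 0 (ball 0 2) ?I v" and super: "viscosity_supersolution p s 0 (ball 0 2) ?I v"
    using v by (auto simp: viscosity_solution_def)
  have vL: "v \<in> Linf ?I" using sub by (simp add: viscosity_subsolution_def)
  have quad: "K * (norm (x1 - x0))\<^sup>2 - K * (norm (x1 + y - x0))\<^sup>2 = - (b \<bullet> y) - K * (norm y)\<^sup>2" for y
    unfolding b_def power2_norm_eq_inner by (simp add: algebra_simps inner_commute)
  have "norm b \<le> K * R" using K mult_left_mono[OF x0 K] by (simp add: b_def)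
  from quadratic_principal_value[OF p s K R this]
  obtain N where q: "\<And>\<epsilon>. 0 < \<epsilon> \<Longrightarrow> integrable lebesgue (\<lambda>y. quadratic_integrand p s K b y * indicator {y. \<epsilon> < norm y \<and> norm y < R} y)"
    and Nlim: "((\<lambda>\<epsilon>. LINT y|lebesgue. quadratic_integrand p s K b y * indicator {y. \<epsilon> < norm y \<and> norm y < R} y) \<longlongrightarrow> N) (at_right 0)"
    and N: "\<bar>N\<bar> \<le> near_const DIM('a) p s * K powr (p - 1) * R powr (2 * p - 2 - s * p)" by blast
  define D where "D y = odd_powr p (u (x1, t1) - u (x1 + y, t1))
      - (if norm y < R then odd_powr p (- (b \<bullet> y) - K * (norm y)\<^sup>2) else 0)" for y
  define H where "H y = (if norm y < r then 0 else D y / ?k y)" for y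
  define M where "M = enn2real (Linf_norm ?I v)"
  define B where "B = (2 * M + \<bar>u (x1, t1)\<bar>) powr (p - 1) + (norm b * R + K * R\<^sup>2) powr (p - 1)"
  have um: "(\<lambda>y. u (x1 + y, t1)) \<in> borel_measurable lebesgue"
  proof -
    have "(\<lambda>x. v (x, t1)) \<in> borel_measurable lebesgue" using vL t1 by (auto simp: Linf_def)
    from borel_measurable_lebesgue_translate[OF this] show ?thesis unfolding u by simp
  qed
  have ub: "AE y in lebesgue. \<bar>u (x1 + y, t1)\<bar> \<le> M"
    using AE_lebesgue_translate[OF Linf_AE_bound[OF vL], of t1 x1] t1 \<sigma>
    by (auto simp: u M_def abs_mult)
  have DB: "AE y in lebesgue. \<bar>D y\<bar> \<le> B"
    using ub
  proof eventually_elim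
    case (elim y)
    have M0: "0 \<le> M" by (simp add: M_def)
    have "\<bar>odd_powr p (u (x1, t1) - u (x1 + y, t1))\<bar> \<le> (2 * M + \<bar>u (x1, t1)\<bar>) powr (p - 1)"
      unfolding abs_odd_powr[OF p] using elim p M0 by (intro powr_mono2) auto
    moreover have "\<bar>odd_powr p (- (b \<bullet> y) - K * (norm y)\<^sup>2)\<bar> \<le> (norm b * R + K * R\<^sup>2) powr (p - 1)" if y: "norm y < R"
    proof -
      have "\<bar>b \<bullet> y\<bar> \<le> norm b * R"
        using Cauchy_Schwarz_ineq2[of b y] mult_left_mono[of "norm y" R "norm b"] y by simp
      moreover have "K * (norm y)\<^sup>2 \<le> K * R\<^sup>2" "0 \<le> K * (norm y)\<^sup>2"
        using y K by (auto intro!: mult_left_mono power_mono)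
      ultimately show ?thesis unfolding abs_odd_powr[OF p] using p by (intro powr_mono2) auto
    qed
    ultimately show ?case
      unfolding D_def B_def by (smt (verit) powr_ge_zero)
  qed
  have B: "0 \<le> B" by (simp add: B_def)
  have Hm: "H \<in> borel_measurable lebesgue"
  proof -
    have [measurable]: "(\<lambda>y::'a. norm y) \<in> borel_measurable lebesgue" "(\<lambda>y. b \<bullet> y) \<in> borel_measurable lebesgue"
      by (auto intro: measurable_completion)
    note um[measurable]
    show ?thesis unfolding H_def D_def by measurable
  qed
  have Hi: "integrable lebesgue H"
  proof (rule Bochner_Integration.integrable_bound)
    show "integrable lebesgue (\<lambda>y::'a. B * (norm y powr (- real DIM('a) - s * p) * indicator (- ball 0 r) y))"
      using p s r by (intro integrable_mult_right integral_norm_powr_far(1)) auto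
    show "AE y in lebesgue. norm (H y) \<le> norm (B * (norm y powr (- real DIM('a) - s * p) * indicator (- ball 0 r) y))"
      using DB
    proof eventually_elim
      case (elim y)
      show ?case
      proof (cases "norm y < r")
        case False
        have "?k y = 1 / norm y powr (- real DIM('a) - s * p)"
          by (simp add: powr_minus_divide[symmetric] algebra_simps)
        moreover have "\<bar>D y\<bar> * norm y powr (- real DIM('a) - s * p) \<le> B * norm y powr (- real DIM('a) - s * p)"
          using elim by (intro mult_right_mono) auto
        ultimately show ?thesis using False B by (simp add: H_def abs_mult)
      qed (simp add: H_def)
    qed
  qed (rule Hm)
  have LH: "integral\<^sup>L lebesgue L \<le> integral\<^sup>L lebesgue H"
  proof (rule integral_mono_AE[OF L Hi])
    show "AE y in lebesgue. L y \<le> H y"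
      using L2 L3
    proof eventually_elim
      case (elim y)
      then show ?case using L1[of y] r by (auto simp: H_def D_def quad)
    qed
  qed
  let ?P = "patch \<phi> u ?I (x1, t1) r"
  let ?V = "patch (\<lambda>z. \<sigma> * \<phi> z) v ?I (x1, t1) r"
  have P: "?P (x1 + y, t1) = (if norm y < r then \<phi> (x1 + y, t1) else u (x1 + y, t1))" for y
    using r by (auto simp: patch_def nb dist_norm)
  have VP: "?V z = \<sigma> * ?P z" for z using \<sigma>\<sigma> by (simp add: patch_def u)
  have P0: "?P (x1, t1) = u (x1, t1)" using P[of 0] r touch by (simp add: \<phi>_def)
  have decomp: "odd_powr p (?P (x1, t1) - ?P (x1 + y, t1)) / ?k y
      = H y + quadratic_integrand p s K b y * indicator (ball 0 R) y" for y
  proof (cases "norm y < r")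
    case True
    have "?P (x1, t1) - ?P (x1 + y, t1) = - (b \<bullet> y) - K * (norm y)\<^sup>2"
      using True quad[of y] unfolding P0 P touch by (simp add: \<phi>_def)
    then show ?thesis using True r by (simp add: H_def quadratic_integrand_def)
  next
    case False
    then show ?thesis unfolding P0 P
      by (auto simp: H_def D_def quadratic_integrand_def indicator_def diff_divide_distrib)
  qed
  have odd\<sigma>: "odd_powr p (\<sigma> * a) = \<sigma> * odd_powr p a" for a using \<sigma> by (auto simp: odd_powr_minus)
  have frac: "fractional_p_laplacian p s ?V (x1, t1) = ereal (2 * (\<sigma> * N + integral\<^sup>L lebesgue (\<lambda>y. \<sigma> * H y)))"
  proof (rule fractional_p_laplacian_eq[where r = r and R = R and q = "\<lambda>y. \<sigma> * quadratic_integrand p s K b y"])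
    show "integrable lebesgue (\<lambda>y. \<sigma> * H y)" using Hi by simp
    show "\<sigma> * H y = 0" if "norm y < r" for y using that by (simp add: H_def)
    show "integrable lebesgue (\<lambda>y. \<sigma> * quadratic_integrand p s K b y * indicator {y. \<epsilon> < norm y \<and> norm y < R} y)" if "0 < \<epsilon>" for \<epsilon>
      using integrable_mult_right[OF q[OF that], of \<sigma>] by (simp add: mult.assoc)
    show "((\<lambda>\<epsilon>. LINT y|lebesgue. \<sigma> * quadratic_integrand p s K b y * indicator {y. \<epsilon> < norm y \<and> norm y < R} y) \<longlongrightarrow> \<sigma> * N) (at_right 0)"
      using tendsto_mult_left[OF Nlim, of \<sigma>] by (simp add: mult.assoc)
    show "odd_powr p (?V (x1, t1) - ?V (x1 + y, t1)) / ?k y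
        = \<sigma> * H y + \<sigma> * quadratic_integrand p s K b y * indicator (ball 0 R) y" for y
    proof -
      have "odd_powr p (?V (x1, t1) - ?V (x1 + y, t1)) / ?k y = \<sigma> * (odd_powr p (?P (x1, t1) - ?P (x1 + y, t1)) / ?k y)"
        unfolding VP right_diff_distrib[symmetric] odd\<sigma> by simp
      then show ?thesis unfolding decomp by (simp add: algebra_simps)
    qed
  qed (use r in auto)
  have "C21_on (ball x1 r) (time_nbhd ?I t1 r) (\<lambda>(x, t). \<sigma> * C + \<sigma> * K * (norm (x - x0))\<^sup>2 - \<sigma> * m t) (\<lambda>(x, t). - (\<sigma> * m' t))"
    unfolding nb
    by (rule C21_on_quadratic) (auto intro!: DERIV_cmult has_field_derivative_at_within[OF m] continuous_intros m')
  moreover have "(\<lambda>(x, t). \<sigma> * C + \<sigma> * K * (norm (x - x0))\<^sup>2 - \<sigma> * m t) = (\<lambda>z. \<sigma> * \<phi> z)"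
    by (auto simp: \<phi>_def algebra_simps)
  ultimately have C21: "C21_on (ball x1 r) (time_nbhd ?I t1 r) (\<lambda>z. \<sigma> * \<phi> z) (\<lambda>(x, t). - (\<sigma> * m' t))" by simp
  have vu: "v z = \<sigma> * u z" for z using \<sigma>\<sigma> by (simp add: u mult.assoc[symmetric])
  have t1I: "t1 \<in> ?I" using t1 by auto
  have eq: "\<sigma> * \<phi> (x1, t1) = v (x1, t1)" using touch by (simp add: vu \<phi>_def)
  have ab: "u z \<le> \<phi> z" if "z \<in> ball x1 r \<times> time_nbhd ?I t1 r" for z
    using above that unfolding nb by (auto simp: \<phi>_def)
  have "2 * (N + integral\<^sup>L lebesgue H) \<le> odd_powr p (m' t1)"
    using \<sigma>
  proof
    assume 1: "\<sigma> = 1"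
    have "ereal (odd_powr p (- (\<sigma> * m' t1))) + fractional_p_laplacian p s ?V (x1, t1) \<le> ereal 0"
      using sub[unfolded viscosity_subsolution_def, THEN conjunct2, THEN conjunct2, rule_format,
        OF x1 t1I r(1), of "\<lambda>z. \<sigma> * \<phi> z" "\<lambda>(x, t). - (\<sigma> * m' t)"] C21 eq ab by (simp add: 1 vu)
    then show ?thesis unfolding frac by (simp add: 1 odd_powr_minus)
  next
    assume 1: "\<sigma> = -1"
    have "ereal 0 \<le> ereal (odd_powr p (- (\<sigma> * m' t1))) + fractional_p_laplacian p s ?V (x1, t1)"
      using super[unfolded viscosity_supersolution_def, THEN conjunct2, THEN conjunct2, rule_format,
        OF x1 t1I r(1), of "\<lambda>z. \<sigma> * \<phi> z" "\<lambda>(x, t). - (\<sigma> * m' t)"] C21 eq ab by (simp add: 1 vu)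
    then show ?thesis unfolding frac by (simp add: 1)
  qed
  then show ?thesis using LH N by (simp add: abs_le_iff)
qed

section \<open>Decrease of the supremum\<close>

text \<open>The closed cube with centre \<open>x0\<close> and side length \<open>\<rho> / n\<close>, so that it lies in the ball of radius \<open>\<rho>\<close>.
  Averages are taken over cubes since these are boxes, for which continuous dependence of
  integrals on parameters is immediate.\<close>

definition cube :: "'a::euclidean_space \<Rightarrow> real \<Rightarrow> 'a set" where
  "cube x0 \<rho> = cbox (x0 - (\<rho> / (2 * real DIM('a))) *\<^sub>R One) (x0 + (\<rho> / (2 * real DIM('a))) *\<^sub>R One)"

lemma cube_subset_ball:
  fixes x0 :: "'a::euclidean_space"
  assumes "0 < \<rho>" shows "cube x0 \<rho> \<subseteq> ball x0 \<rho>"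
proof
  fix z assume z: "z \<in> cube x0 \<rho>"
  have "norm (z - x0) \<le> (\<Sum>i\<in>Basis. \<bar>(z - x0) \<bullet> i\<bar>)" by (rule norm_le_l1)
  also have "\<dots> \<le> (\<Sum>i\<in>(Basis::'a set). \<rho> / (2 * real DIM('a)))"
    using z by (intro sum_mono) (fastforce simp: cube_def mem_box inner_diff_left inner_add_left abs_le_iff)
  also have "\<dots> = \<rho> / 2" by simp
  also have "\<dots> < \<rho>" using assms by simp
  finally show "z \<in> ball x0 \<rho>" by (simp add: dist_norm norm_minus_commute)
qed

lemma content_cube:
  fixes x0 :: "'a::euclidean_space"
  assumes "0 < \<rho>" shows "measure lborel (cube x0 \<rho>) = (\<rho> / real DIM('a)) ^ DIM('a)"
proof -
  have "measure lborel (cube x0 \<rho>) = (\<Prod>i\<in>(Basis::'a set). \<rho> / real DIM('a))"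
    unfolding cube_def using assms
    by (subst content_cbox) (auto simp: inner_diff_left inner_add_left intro!: prod.cong)
  then show ?thesis by simp
qed

text \<open>With \<open>A\<close> the half width of the range of \<open>u\<close> and \<open>M\<close> its upper end, the weight is \<open>1\<close> where \<open>u\<close> lies in
  the lower half of the range and \<open>0\<close> in the upper quarter. Unlike the measure of a sublevel set, its average over a
  cube depends continuously on time.\<close>

definition low_weight :: "real \<Rightarrow> real \<Rightarrow> real \<Rightarrow> real" where
  "low_weight M A w = max 0 (min 1 (2 * (M - w) / A - 1))"

definition low_average ::
  "('a::euclidean_space \<times> real \<Rightarrow> real) \<Rightarrow> real \<Rightarrow> real \<Rightarrow> 'a \<Rightarrow> real \<Rightarrow> real \<Rightarrow> real" where
  "low_average u M A x0 \<rho> t = integral (cube x0 \<rho>) (\<lambda>z. low_weight M A (u (z, t))) / measure lborel (cube x0 \<rho>)"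

lemma low_weight_bounds: "0 \<le> low_weight M A w" "low_weight M A w \<le> 1"
  by (auto simp: low_weight_def)

lemma continuous_on_low_weight [continuous_intros]:
  "continuous_on S f \<Longrightarrow> continuous_on S (\<lambda>x. low_weight M A (f x))"
  unfolding low_weight_def divide_inverse by (intro continuous_intros)

lemma low_weight_sum:
  assumes "M + M' = 2 * A" "0 < A"
  shows "1 \<le> low_weight M A w + low_weight M' A (- w)"
proof -
  have "(2 * (M - w) / A - 1) + (2 * (M' - - w) / A - 1) = 2 * (M + M') / A - 2"
    by (simp add: diff_divide_distrib add_divide_distrib algebra_simps)
  then have "(2 * (M - w) / A - 1) + (2 * (M' - - w) / A - 1) = 2"
    using assms by simp
  then show ?thesis unfolding low_weight_def by linarith
qed

lemma continuous_on_low_average: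
  fixes x0 :: "'a::euclidean_space"
  assumes "continuous_on (cube x0 \<rho> \<times> J) u"
  shows "continuous_on J (low_average u M A x0 \<rho>)"
proof -
  have "continuous_on (J \<times> cube x0 \<rho>) (\<lambda>w. u (snd w, fst w))"
    by (rule continuous_on_compose2[OF assms]) (auto intro!: continuous_intros)
  then have "continuous_on (J \<times> cube x0 \<rho>) (\<lambda>(t, z). low_weight M A (u (z, t)))"
    by (simp add: case_prod_beta continuous_on_low_weight)
  then show ?thesis
    unfolding low_average_def divide_inverse cube_def
    by (intro continuous_intros integral_continuous_on_param)
qed

lemma low_weight_integrable_on:
  assumes "continuous_on (cube x0 \<rho>) (\<lambda>z. u (z, t))"
  shows "(\<lambda>z. low_weight M A (u (z, t))) integrable_on cube x0 \<rho>"
  using continuous_on_low_weight[OF assms] unfolding cube_def by (rule integrable_continuous)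

lemma low_average_bounds:
  assumes "continuous_on (cube x0 \<rho>) (\<lambda>z. u (z, t))" "0 < \<rho>"
  shows "0 \<le> low_average u M A x0 \<rho> t" "low_average u M A x0 \<rho> t \<le> 1"
proof -
  note i = low_weight_integrable_on[of x0 \<rho> u t, OF assms(1)]
  have pos: "0 < measure lborel (cube x0 \<rho>)" using assms(2) by (simp add: content_cube)
  have "integral (cube x0 \<rho>) (\<lambda>z. low_weight M A (u (z, t))) \<le> integral (cube x0 \<rho>) (\<lambda>z. 1)"
    using i by (intro integral_le) (auto simp: low_weight_bounds cube_def)
  also have "\<dots> = measure lborel (cube x0 \<rho>)" by (simp add: cube_def)
  finally show "low_average u M A x0 \<rho> t \<le> 1" using pos by (simp add: low_average_def)
  show "0 \<le> low_average u M A x0 \<rho> t"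
    unfolding low_average_def by (intro divide_nonneg_nonneg integral_nonneg i) (auto simp: low_weight_bounds)
qed

lemma low_average_sum:
  assumes c: "continuous_on (cube x0 \<rho>) (\<lambda>z. u (z, t))" and r: "0 < \<rho>" and M: "M + M' = 2 * A" "0 < A"
  shows "1 \<le> low_average u M A x0 \<rho> t + low_average (\<lambda>z. - u z) M' A x0 \<rho> t"
proof -
  have i1: "(\<lambda>z. low_weight M A (u (z, t))) integrable_on cube x0 \<rho>"
    by (rule low_weight_integrable_on[OF c])
  have i2: "(\<lambda>z. low_weight M' A (- u (z, t))) integrable_on cube x0 \<rho>"
    by (rule low_weight_integrable_on[of x0 \<rho> "\<lambda>z. - u z"]) (intro continuous_intros c)
  have pos: "0 < measure lborel (cube x0 \<rho>)" using r by (simp add: content_cube)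
  have "measure lborel (cube x0 \<rho>) = integral (cube x0 \<rho>) (\<lambda>z. 1)" by (simp add: cube_def)
  also have "\<dots> \<le> integral (cube x0 \<rho>) (\<lambda>z. low_weight M A (u (z, t)) + low_weight M' A (- u (z, t)))"
    using i1 i2 low_weight_sum[OF M] by (intro integral_le) (auto simp: cube_def intro!: integrable_add)
  also have "\<dots> = integral (cube x0 \<rho>) (\<lambda>z. low_weight M A (u (z, t))) + integral (cube x0 \<rho>) (\<lambda>z. low_weight M' A (- u (z, t)))"
    by (rule Henstock_Kurzweil_Integration.integral_add[OF i1 i2])
  finally show ?thesis using pos by (simp add: low_average_def add_divide_distrib[symmetric])
qed

lemma lebesgue_integral_translated_cube:
  fixes a :: "'a::euclidean_space"
  assumes f: "continuous_on (cube x0 \<rho>) f"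
  defines "g \<equiv> \<lambda>y. indicator (cube x0 \<rho>) (a + y) * f (a + y)"
  shows "integrable lebesgue g" "integral\<^sup>L lebesgue g = integral (cube x0 \<rho>) (f :: 'a \<Rightarrow> real)"
proof -
  let ?h = "\<lambda>z. indicator (cube x0 \<rho>) z *\<^sub>R f z"
  have hm [measurable]: "?h \<in> borel_measurable borel"
    by (rule borel_measurable_continuous_on_indicator[OF _ f]) (simp add: cube_def)
  have hi: "integrable lborel ?h"
    by (rule borel_integrable_compact[OF _ f]) (simp add: cube_def)
  have d: "distr lborel borel ((+) a) = lborel" by (rule lborel_distr_plus)
  have g: "g = (\<lambda>y. ?h (a + y))" by (simp add: g_def)
  have gm [measurable]: "g \<in> borel_measurable borel"
    unfolding g by (rule measurable_compose[OF _ hm]) simp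
  have "integrable (distr lborel borel ((+) a)) ?h" using hi by (simp add: d)
  then have gi: "integrable lborel g" by (subst (asm) integrable_distr_eq[OF _ hm]) (auto simp: g)
  then show "integrable lebesgue g" by (simp add: integrable_completion)
  have "integral\<^sup>L lborel g = integral\<^sup>L (distr lborel borel ((+) a)) ?h"
    by (subst integral_distr[OF _ hm]) (auto simp: g)
  also have "\<dots> = integral\<^sup>L lborel ?h" by (simp add: d)
  also have "\<dots> = integral UNIV ?h" using integral_lborel[OF hi] by simp
  also have "\<dots> = integral (cube x0 \<rho>) f"
    by (subst integral_restrict_UNIV[symmetric]) (auto intro!: Henstock_Kurzweil_Integration.integral_cong simp: indicator_def)
  finally show "integral\<^sup>L lebesgue g = integral (cube x0 \<rho>) f" by (simp add: integral_completion)
qed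

text \<open>The scale-free coefficients of the average weight and of \<open>\<delta>\<^bsup>p - 1\<^esup>\<close> in the inequality at a contact point
  below.\<close>

definition gain_const :: "nat \<Rightarrow> real \<Rightarrow> real \<Rightarrow> real" where
  "gain_const n p s = 4 powr (1 - p) * 2 powr (- real n - s * p) * (1 / real n) ^ n"

definition loss_const :: "nat \<Rightarrow> real \<Rightarrow> real \<Rightarrow> real" where
  "loss_const n p s = 2 * 3 powr (p - 1) * annulus_const n s + 2 * 4 powr (p - 1) * near_const n p s"

text \<open>At a point of contact with the barrier, points where \<open>u\<close> is low push the nonlocal term up in
  proportion to their average weight. The curvature of the barrier and the growth of \<open>u\<close> at infinity cost
  only \<open>\<delta>\<^bsup>p - 1\<^esup>\<close>.\<close>

lemma barrier_contact:
  fixes v :: "'a::euclidean_space \<times> real \<Rightarrow> real"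
  assumes p: "2 \<le> p" and s: "0 < s" "s < 1"
    and v: "viscosity_solution p s (ball 0 2) {-2<..0} v"
    and \<sigma>: "\<sigma> = 1 \<or> \<sigma> = -1" and u: "u = (\<lambda>z. \<sigma> * v z)"
    and \<rho>: "0 < \<rho>" and A: "0 < A" and \<delta>: "0 < \<delta>" "\<delta> \<le> 1/8"
    and sub: "ball x0 (3 * \<rho>) \<subseteq> ball 0 2" and x1: "x1 \<in> ball x0 \<rho>"
    and r: "0 < r" "r \<le> 2 * \<rho>" and tr: "{t1 - r<..<t1 + r} \<subseteq> {-2<..<0}"
    and m: "\<And>t. t \<in> {t1 - r<..<t1 + r} \<Longrightarrow> (m has_real_derivative m' t) (at t)"
    and m': "continuous_on {t1 - r<..<t1 + r} m'"
    and touch: "u (x1, t1) = C + A * \<delta> / \<rho>\<^sup>2 * (norm (x1 - x0))\<^sup>2 - m t1"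
    and above: "\<And>x t. x \<in> ball x1 r \<Longrightarrow> t \<in> {t1 - r<..<t1 + r} \<Longrightarrow> u (x, t) \<le> C + A * \<delta> / \<rho>\<^sup>2 * (norm (x - x0))\<^sup>2 - m t"
    and above': "\<And>x. x \<in> ball x0 (3 * \<rho>) \<Longrightarrow> u (x, t1) \<le> C + A * \<delta> / \<rho>\<^sup>2 * (norm (x - x0))\<^sup>2 - m t1"
    and high: "M - A * \<delta> \<le> u (x1, t1)"
    and near: "\<And>x. x \<in> ball x1 r \<Longrightarrow> M - A / 2 \<le> u (x, t1)"
    and cont: "continuous_on (cube x0 \<rho>) (\<lambda>z. u (z, t1))"
    and growth: "AE z in lebesgue. u (z, t1) \<le> M + A * \<delta> * (norm (z - x0) / \<rho>) powr s"
  shows "A powr (p - 1) * \<rho> powr (- (s * p)) *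
      (gain_const DIM('a) p s * low_average u M A x0 \<rho> t1 - loss_const DIM('a) p s * \<delta> powr (p - 1))
    \<le> odd_powr p (m' t1)"
proof -
  define n where "n = DIM('a)"
  define K where "K = A * \<delta> / \<rho>\<^sup>2"
  define \<kappa> where "\<kappa> = real n + s * p"
  define c where "c = 4 powr (1 - p) / 2 * A powr (p - 1) * (2 * \<rho>) powr (- \<kappa>)"
  define d where "d = (3 * (A * \<delta>)) powr (p - 1) * \<rho> powr (- (s * (p - 1)))"
  define G where "G y = indicator (cube x0 \<rho>) (x1 + y) * low_weight M A (u (x1 + y, t1))" for y
  define F where "F y = norm y powr (- real DIM('a) - s) * indicator (- ball 0 (2 * \<rho>)) y" for y :: 'a
  \<comment> \<open>The minorant: a gain on the cube, and a loss at distance at least \<open>2 \<rho>\<close>, where \<open>u\<close> may exceed \<open>M\<close>.\<close>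
  define L where "L y = c * G y - d * F y" for y
  have c0: "0 \<le> c" and d0: "0 \<le> d" by (auto simp: c_def d_def)
  have n0: "0 < real n" by (simp add: n_def)
  have \<kappa>0: "0 < \<kappa>" using n0 s p by (simp add: \<kappa>_def add_pos_nonneg)
  have K0: "0 \<le> K" using A \<delta> by (simp add: K_def)
  have K\<rho>: "K * \<rho>\<^sup>2 = A * \<delta>" using \<rho> by (simp add: K_def)
  have nx: "norm (x1 - x0) < \<rho>" using x1 by (simp add: dist_norm norm_minus_commute)
  have Gint: "integrable lebesgue G" "integral\<^sup>L lebesgue G = measure lborel (cube x0 \<rho>) * low_average u M A x0 \<rho> t1"
    using lebesgue_integral_translated_cube[OF continuous_on_low_weight[OF cont, of M A], of x1] \<rho>
    unfolding G_def[symmetric] by (auto simp: low_average_def content_cube)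
  have "0 < 2 * \<rho>" using \<rho> by simp
  note F = integral_norm_powr_far[OF s(1) this, where ?'a = 'a, folded F_def[abs_def]]
  have Li: "integrable lebesgue L" unfolding L_def using Gint(1) F(1) by simp
  have G0: "G y = 0" if "M - A / 2 \<le> u (x1 + y, t1)" for y
    using that A by (simp add: G_def low_weight_def field_simps max_def)
  have Gb: "0 \<le> G y" "G y \<le> 1" for y
    by (auto simp: G_def low_weight_bounds indicator_def)
  have Fb: "0 \<le> F y" for y by (simp add: F_def)
  have far: "G y = 0" if "2 * \<rho> \<le> norm y" for y
  proof -
    have "\<not> norm (x1 + y - x0) < \<rho>"
      using that nx norm_triangle_ineq4[of "x1 + y - x0" "x1 - x0"] by (auto simp: algebra_simps)
    then show ?thesis using cube_subset_ball[OF \<rho>, of x0]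
      by (auto simp: G_def indicator_def dist_norm norm_minus_commute)
  qed
  have main: "2 * integral\<^sup>L lebesgue L \<le> odd_powr p (m' t1)
     + 2 * (near_const DIM('a) p s * K powr (p - 1) * (2 * \<rho>) powr (2 * p - 2 - s * p))"
  proof (rule viscosity_touching[OF p s v \<sigma> u _ K0 _ _ r tr m m' _ _ Li])
    show "x1 \<in> ball 0 2" using x1 \<rho> by (intro subsetD[OF sub]) simp
    show "norm (x1 - x0) \<le> 2 * \<rho> / 2" using nx by simp
    show "L y \<le> 0" if "norm y < r" for y
      using G0[of y] near[of "x1 + y"] that mult_nonneg_nonneg[OF d0 Fb[of y]] by (simp add: L_def dist_norm)
    show "AE y in lebesgue. r \<le> norm y \<and> norm y < 2 * \<rho> \<longrightarrow>
       L y \<le> (odd_powr p (u (x1, t1) - u (x1 + y, t1))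
          - odd_powr p (K * (norm (x1 - x0))\<^sup>2 - K * (norm (x1 + y - x0))\<^sup>2)) / norm y powr (real DIM('a) + s * p)"
    proof (intro AE_I2 impI, elim conjE)
      fix y :: 'a assume y: "r \<le> norm y" "norm y < 2 * \<rho>"
      let ?X = "u (x1, t1) - u (x1 + y, t1)" and ?Y = "K * (norm (x1 - x0))\<^sup>2 - K * (norm (x1 + y - x0))\<^sup>2"
      have y0: "0 < norm y" using y(1) r(1) by linarith
      have "norm (x1 + y - x0) < 3 * \<rho>"
        using norm_triangle_ineq[of "x1 - x0" y] nx y by (simp add: algebra_simps)
      then have "x1 + y \<in> ball x0 (3 * \<rho>)" by (simp add: dist_norm norm_minus_commute)
      from above'[OF this] have XY: "?Y \<le> ?X" using touch by (simp add: K_def)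
      have F0: "F y = 0" using y by (simp add: F_def)
      show "L y \<le> (odd_powr p ?X - odd_powr p ?Y) / norm y powr (real DIM('a) + s * p)"
      proof (cases "M - A / 2 \<le> u (x1 + y, t1)")
        case True
        then show ?thesis using odd_powr_mono[OF p XY] F0 G0[OF True] by (simp add: L_def)
      next
        case False
        have "A * \<delta> \<le> A / 8" using A \<delta> by simp
        then have X: "A / 4 \<le> ?X" using False high A by linarith
        have "K * (norm (x1 - x0))\<^sup>2 \<le> K * \<rho>\<^sup>2" using nx K0 by (intro mult_left_mono power_mono) auto
        moreover have "0 \<le> K * (norm (x1 + y - x0))\<^sup>2" using K0 by simp
        ultimately have Y: "?Y \<le> A / 8" using K\<rho> \<open>A * \<delta> \<le> A / 8\<close> by linarith
        have 4: "(A / 4) powr (p - 1) = 4 powr (1 - p) * A powr (p - 1)"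
          using A powr_minus_divide[of 4 "p - 1"] by (simp add: powr_divide)
        have "(A / 8) powr (p - 1) = (A / 4) powr (p - 1) * (1 / 2) powr (p - 1)"
          using A by (subst powr_mult[symmetric]) auto
        also have "(1 / 2 :: real) powr (p - 1) \<le> (1 / 2) powr 1"
          using p by (intro powr_mono') auto
        finally have 8: "(A / 8) powr (p - 1) \<le> (A / 4) powr (p - 1) / 2"
          by (simp add: mult_left_mono)
        have "(A / 4) powr (p - 1) \<le> odd_powr p ?X"
          using odd_powr_mono[OF p X] odd_powr_nonneg[of "A / 4" p] A p by simp
        moreover have "odd_powr p ?Y \<le> (A / 8) powr (p - 1)"
          using odd_powr_mono[OF p Y] odd_powr_nonneg[of "A / 8" p] A p by simp
        ultimately have num: "4 powr (1 - p) / 2 * A powr (p - 1) \<le> odd_powr p ?X - odd_powr p ?Y"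
          using 8 4 by linarith
        have ker: "(2 * \<rho>) powr (- \<kappa>) \<le> norm y powr (- \<kappa>)"
          using y y0 \<kappa>0 by (intro powr_mono2') auto
        have "L y \<le> c" using F0 Gb[of y] c0 by (simp add: L_def mult_left_le)
        also have "\<dots> \<le> (odd_powr p ?X - odd_powr p ?Y) * norm y powr (- \<kappa>)"
          unfolding c_def by (rule mult_mono[OF num ker]) (use odd_powr_mono[OF p XY] in simp_all)
        also have "\<dots> = (odd_powr p ?X - odd_powr p ?Y) / norm y powr (real DIM('a) + s * p)"
          unfolding \<kappa>_def n_def powr_minus_divide by simp
        finally show ?thesis .
      qed
    qed
    show "AE y in lebesgue. 2 * \<rho> \<le> norm y \<longrightarrow>
       L y \<le> odd_powr p (u (x1, t1) - u (x1 + y, t1)) / norm y powr (real DIM('a) + s * p)"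
      using AE_lebesgue_translate[OF growth, of x1]
    proof (eventually_elim, intro impI)
      fix y :: 'a assume g: "u (x1 + y, t1) \<le> M + A * \<delta> * (norm (x1 + y - x0) / \<rho>) powr s"
        and y: "2 * \<rho> \<le> norm y"
      have y0: "0 < norm y" using y \<rho> by linarith
      let ?e = "(norm y / \<rho>) powr s"
      have "x1 + y - x0 = (x1 - x0) + y" by simp
      then have "norm (x1 + y - x0) \<le> norm (x1 - x0) + norm y"
        using norm_triangle_ineq[of "x1 - x0" y] by metis
      then have "norm (x1 + y - x0) \<le> 2 * norm y" using nx y y0 by linarith
      then have "(norm (x1 + y - x0) / \<rho>) powr s \<le> (2 * (norm y / \<rho>)) powr s"
        using \<rho> s by (intro powr_mono2) (auto simp: field_simps)
      also have "\<dots> = 2 powr s * ?e" using \<rho> by (subst powr_mult) auto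
      also have "\<dots> \<le> 2 * ?e"
        using powr_mono[of s 1 2] s by (intro mult_right_mono) auto
      finally have "A * \<delta> * (norm (x1 + y - x0) / \<rho>) powr s \<le> A * \<delta> * (2 * ?e)"
        using A \<delta> by (intro mult_left_mono) auto
      moreover have "A * \<delta> * 1 \<le> A * \<delta> * ?e"
        using A \<delta> \<rho> y s by (intro mult_left_mono ge_one_powr_ge_zero) (auto simp: field_simps)
      ultimately have X: "- (3 * (A * \<delta>) * ?e) \<le> u (x1, t1) - u (x1 + y, t1)"
        using g high by (simp add: algebra_simps)
      have "odd_powr p (3 * (A * \<delta>) * ?e) = (3 * (A * \<delta>) * ?e) powr (p - 1)"
        using A \<delta> p by (intro odd_powr_nonneg) auto
      also have "\<dots> = (3 * (A * \<delta>)) powr (p - 1) * ?e powr (p - 1)"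
        using A \<delta> by (subst powr_mult) auto
      also have "?e powr (p - 1) = \<rho> powr (- (s * (p - 1))) * norm y powr (s * (p - 1))"
      proof -
        have "?e powr (p - 1) = (norm y / \<rho>) powr (s * (p - 1))" by (simp only: powr_powr)
        also have "\<dots> = norm y powr (s * (p - 1)) / \<rho> powr (s * (p - 1))"
          using \<rho> by (subst powr_divide) auto
        finally show ?thesis by (simp only: powr_minus_divide) simp
      qed
      finally have "- (d * norm y powr (s * (p - 1))) \<le> odd_powr p (u (x1, t1) - u (x1 + y, t1))"
        using odd_powr_mono[OF p X] by (simp add: odd_powr_minus d_def mult.assoc)
      then have "- (d * norm y powr (s * (p - 1))) / norm y powr (real DIM('a) + s * p)
           \<le> odd_powr p (u (x1, t1) - u (x1 + y, t1)) / norm y powr (real DIM('a) + s * p)"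
        by (rule divide_right_mono) simp
      moreover have "L y = - (d * norm y powr (s * (p - 1))) / norm y powr (real DIM('a) + s * p)"
      proof -
        have e: "norm y powr (s * (p - 1)) / norm y powr (real DIM('a) + s * p) = norm y powr (- real DIM('a) - s)"
          by (subst powr_diff[symmetric], rule arg_cong[where f = "(powr) (norm y)"]) (simp add: algebra_simps)
        have "L y = - (d * norm y powr (- real DIM('a) - s))" using far[OF y] y by (simp add: L_def F_def)
        then show ?thesis unfolding e[symmetric] by simp
      qed
      ultimately show "L y \<le> odd_powr p (u (x1, t1) - u (x1 + y, t1)) / norm y powr (real DIM('a) + s * p)" by simp
    qed
  qed (use touch above \<rho> in \<open>auto simp: K_def\<close>)
  define E where "E = A powr (p - 1) * \<rho> powr (- (s * p))"
  have gain: "2 * (c * (measure lborel (cube x0 \<rho>) * g)) = E * (gain_const n p s * g)" for g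
  proof -
    have "measure lborel (cube x0 \<rho>) = \<rho> powr (real n) * (1 / real n) ^ n"
      using \<rho> by (simp add: content_cube n_def power_divide powr_realpow)
    moreover have "(2 * \<rho>) powr (- \<kappa>) = 2 powr (- real n - s * p) * (\<rho> powr (- (s * p)) * \<rho> powr (- real n))"
    proof -
      have "\<rho> powr (- (s * p)) * \<rho> powr (- real n) = \<rho> powr (- real n - s * p)"
        by (subst powr_add[symmetric], rule arg_cong[where f = "(powr) \<rho>"]) (simp add: algebra_simps)
      moreover have "- \<kappa> = - real n - s * p" by (simp add: \<kappa>_def)
      ultimately show ?thesis using \<rho> by (simp only:) (subst powr_mult, auto)
    qed
    moreover have "\<rho> powr (- real n) * \<rho> powr (real n) = 1" using \<rho> by (simp flip: powr_add)
    ultimately show ?thesis unfolding c_def E_def gain_const_def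
      by (simp add: mult_ac)
  qed
  have loss1: "d * integral\<^sup>L lebesgue F \<le> E * (3 powr (p - 1) * annulus_const n s * \<delta> powr (p - 1))"
  proof -
    have "(2 * \<rho>) powr (- s) \<le> \<rho> powr (- s)" using \<rho> s by (intro powr_mono2') auto
    then have "integral\<^sup>L lebesgue F \<le> annulus_const n s * \<rho> powr (- s)"
      using F(2) annulus_const_nonneg[OF s(1), of n] unfolding n_def
      by (meson mult_left_mono order_trans)
    then have "d * integral\<^sup>L lebesgue F \<le> d * (annulus_const n s * \<rho> powr (- s))"
      using d0 by (rule mult_left_mono)
    also have "\<dots> = (3 * (A * \<delta>)) powr (p - 1) * annulus_const n s * (\<rho> powr (- (s * (p - 1))) * \<rho> powr (- s))"
      by (simp add: d_def mult_ac)
    also have "\<rho> powr (- (s * (p - 1))) * \<rho> powr (- s) = \<rho> powr (- (s * p))"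
      by (subst powr_add[symmetric], rule arg_cong[where f = "(powr) \<rho>"]) (simp add: algebra_simps)
    also have "(3 * (A * \<delta>)) powr (p - 1) = 3 powr (p - 1) * A powr (p - 1) * \<delta> powr (p - 1)"
      using A \<delta> by (simp only: powr_mult)
    finally show ?thesis by (simp add: E_def mult_ac)
  qed
  have loss2: "K powr (p - 1) * (2 * \<rho>) powr (2 * p - 2 - s * p) \<le> E * (4 powr (p - 1) * \<delta> powr (p - 1))"
  proof -
    have "(2::real) powr (2 * p - 2 - s * p) \<le> 2 powr (2 * (p - 1))"
      using p s by (intro powr_mono) auto
    also have "\<dots> = (2 powr 2) powr (p - 1)" by (simp only: powr_powr)
    finally have 2: "(2::real) powr (2 * p - 2 - s * p) \<le> 4 powr (p - 1)" by simp
    have "K = A * \<delta> * \<rho> powr (- 2)" using \<rho> by (simp add: K_def powr_minus_divide)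
    then have "K powr (p - 1) = A powr (p - 1) * \<delta> powr (p - 1) * \<rho> powr (- 2 * (p - 1))"
      using A \<delta> by (simp add: powr_mult powr_powr)
    moreover have "(2 * \<rho>) powr (2 * p - 2 - s * p) = 2 powr (2 * p - 2 - s * p) * \<rho> powr (2 * p - 2 - s * p)"
      using \<rho> by (simp add: powr_mult)
    ultimately have "K powr (p - 1) * (2 * \<rho>) powr (2 * p - 2 - s * p)
        = A powr (p - 1) * \<delta> powr (p - 1) * (\<rho> powr (- 2 * (p - 1)) * \<rho> powr (2 * p - 2 - s * p)) * 2 powr (2 * p - 2 - s * p)"
      by (simp add: mult_ac)
    also have "\<rho> powr (- 2 * (p - 1)) * \<rho> powr (2 * p - 2 - s * p) = \<rho> powr (- (s * p))"
      by (subst powr_add[symmetric], rule arg_cong[where f = "(powr) \<rho>"]) (simp add: algebra_simps)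
    also have "A powr (p - 1) * \<delta> powr (p - 1) * \<rho> powr (- (s * p)) * 2 powr (2 * p - 2 - s * p)
        \<le> A powr (p - 1) * \<delta> powr (p - 1) * \<rho> powr (- (s * p)) * 4 powr (p - 1)"
      using 2 by (intro mult_left_mono) auto
    finally show ?thesis by (simp add: E_def mult_ac)
  qed
  have "near_const n p s * (K powr (p - 1) * (2 * \<rho>) powr (2 * p - 2 - s * p))
      \<le> near_const n p s * (E * (4 powr (p - 1) * \<delta> powr (p - 1)))"
    using loss2 near_const_nonneg[OF p s(2)] by (rule mult_left_mono)
  moreover have "integral\<^sup>L lebesgue L = c * (measure lborel (cube x0 \<rho>) * low_average u M A x0 \<rho> t1) - d * integral\<^sup>L lebesgue F"
    unfolding L_def using Gint F(1) by simp
  ultimately have "E * (gain_const n p s * low_average u M A x0 \<rho> t1)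
      - 2 * (E * (3 powr (p - 1) * annulus_const n s * \<delta> powr (p - 1)))
      - 2 * (near_const n p s * (E * (4 powr (p - 1) * \<delta> powr (p - 1)))) \<le> odd_powr p (m' t1)"
    using main loss1 gain[of "low_average u M A x0 \<rho> t1"] unfolding n_def[symmetric] by (simp add: mult.assoc)
  then show ?thesis unfolding E_def[symmetric] n_def[symmetric] loss_const_def by (simp add: algebra_simps)
qed

text \<open>In units of \<open>A \<rho>\<^bsup>-\<beta>\<^esup>\<close> the speed of \<open>m\<close> is \<open>16 B \<delta> g - 2 B \<delta>\<close> when the average weight is \<open>g\<close>. This is too
  small for a contact: where \<open>g \<le> 1/16\<close> it is at most \<open>- B \<delta>\<close>, which outweighs the loss, and
  otherwise the gain exceeds everything of order \<open>\<delta>\<^bsup>p - 1\<^esup>\<close>.\<close>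

lemma barrier_speed:
  assumes p: "2 \<le> p" and B: "1 \<le> B" "L < B powr (p - 1)" and L: "0 \<le> L" and \<delta>: "0 < \<delta>" "\<delta> \<le> 1"
    and small: "\<delta> * ((16 * B) powr (p - 1) + L) < c / 16" and g: "0 \<le> g" "g \<le> 1"
  shows "odd_powr p (16 * B * \<delta> * g - 2 * B * \<delta>) < c * g - L * \<delta> powr (p - 1)"
proof -
  have d: "0 < \<delta> powr (p - 1)" using \<delta> by simp
  have "0 \<le> \<delta> * ((16 * B) powr (p - 1) + L)" using L \<delta> by (intro mult_nonneg_nonneg add_nonneg_nonneg) auto
  then have c: "0 < c" using small by linarith
  show ?thesis
  proof (cases "g \<le> 1 / 16")
    case True
    have "16 * B * \<delta> * g \<le> B * \<delta>" using True B \<delta> mult_left_mono[OF True, of "16 * B * \<delta>"] by simp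
    then have "odd_powr p (16 * B * \<delta> * g - 2 * B * \<delta>) \<le> odd_powr p (- (B * \<delta>))"
      by (intro odd_powr_mono[OF p]) simp
    also have "\<dots> = - (B powr (p - 1) * \<delta> powr (p - 1))"
      using B \<delta> p by (simp add: odd_powr_minus odd_powr_nonneg powr_mult)
    also have "\<dots> < - (L * \<delta> powr (p - 1))" using mult_strict_right_mono[OF B(2) d] by simp
    also have "\<dots> \<le> c * g - L * \<delta> powr (p - 1)" using c g by simp
    finally show ?thesis .
  next
    case False
    have dd: "\<delta> powr (p - 1) \<le> \<delta>"
      using powr_mono'[of 1 "p - 1" \<delta>] p \<delta> by simp
    have "16 * B * \<delta> * g \<le> 16 * B * \<delta>" using g B \<delta> by (simp add: mult_left_le)
    moreover have "0 \<le> 2 * B * \<delta>" using B \<delta> by simp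
    ultimately have "odd_powr p (16 * B * \<delta> * g - 2 * B * \<delta>) \<le> odd_powr p (16 * B * \<delta>)"
      by (intro odd_powr_mono[OF p]) linarith
    also have "\<dots> = (16 * B) powr (p - 1) * \<delta> powr (p - 1)"
      using B \<delta> p by (simp add: odd_powr_nonneg powr_mult)
    finally have "odd_powr p (16 * B * \<delta> * g - 2 * B * \<delta>) + L * \<delta> powr (p - 1)
        \<le> ((16 * B) powr (p - 1) + L) * \<delta> powr (p - 1)" by (simp add: distrib_right)
    also have "\<dots> \<le> ((16 * B) powr (p - 1) + L) * \<delta>"
      using dd L by (intro mult_left_mono) auto
    also have "\<dots> < c / 16" using small by (simp add: mult.commute)
    also have "\<dots> \<le> c * g" using False c by simp
    finally show ?thesis by simp
  qed
qed

text \<open>If \<open>u\<close> is low on a fixed part of the first half of the time interval, its upper bound improves in the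
  second half. The barrier is \<open>M - m t + K \<bar>x - x0\<bar>\<^sup>2\<close>, where \<open>m\<close> grows while \<open>u\<close> is low and decays slowly
  otherwise. The length \<open>h\<close> of the half interval is small compared to the decay rate, so that not all of the
  gain is lost. As the test functions must touch on a two-sided time interval, the term
  \<open>\<epsilon> / (T - t)\<close> keeps the contact point away from the final time.\<close>

lemma supremum_decrease:
  fixes v :: "'a::euclidean_space \<times> real \<Rightarrow> real"
  assumes p: "2 \<le> p" and s: "0 < s" "s < 1"
    and v: "viscosity_solution p s (ball 0 2) {-2<..0} v"
    and \<sigma>: "\<sigma> = 1 \<or> \<sigma> = -1" and u: "u = (\<lambda>z. \<sigma> * v z)"
    and cont: "continuous_on (ball 0 2 \<times> {-2<..0}) u"
    and \<rho>: "0 < \<rho>" and A: "0 < A" and \<delta>: "0 < \<delta>" "\<delta> \<le> 1/8"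
    and B: "1 \<le> B" "loss_const DIM('a) p s < B powr (p - 1)"
    and small: "\<delta> * ((16 * B) powr (p - 1) + loss_const DIM('a) p s) < gain_const DIM('a) p s / 16"
    and h: "h = \<rho> powr (s * p / (p - 1)) / (32 * B)"
    and T: "T \<le> 0" "-2 < T - 2 * h" and sub: "ball x0 (3 * \<rho>) \<subseteq> ball 0 2"
    and top: "\<And>x t. x \<in> ball x0 (3 * \<rho>) \<Longrightarrow> t \<in> {T - 2 * h..T} \<Longrightarrow> u (x, t) \<le> M"
    and growth: "\<And>t. t \<in> {T - 2 * h..T} \<Longrightarrow> AE z in lebesgue. u (z, t) \<le> M + A * \<delta> * (norm (z - x0) / \<rho>) powr s"
    and low: "h / 2 \<le> integral {T - 2 * h..T - h} (low_average u M A x0 \<rho>)"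
    and x: "x \<in> ball x0 (\<rho> / 4)" and t: "t \<in> {T - h..T}"
  shows "u (x, t) \<le> M - A * \<delta> / 16"
proof -
  define a where "a = T - 2 * h"
  define w where "w = A * \<rho> powr (- (s * p / (p - 1)))"
  define K where "K = A * \<delta> / \<rho>\<^sup>2"
  define g where "g = low_average u M A x0 \<rho>"
  define \<Gamma> where "\<Gamma> t = integral {a..t} g" for t
  define \<mu> where "\<mu> t = w * (16 * B * \<delta> * \<Gamma> t - 2 * B * \<delta> * (t - a))" for t
  have h0: "0 < h" using h \<rho> B by simp
  have w0: "0 < w" using A \<rho> by (simp add: w_def)
  have "\<rho> powr (- (s * p / (p - 1))) * \<rho> powr (s * p / (p - 1)) = 1"
    using \<rho> by (simp flip: powr_add)
  then have wh: "w * (32 * B * h) = A" using B by (simp add: w_def h mult_ac)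
  have K\<rho>: "K * \<rho>\<^sup>2 = A * \<delta>" and K0: "0 < K" using \<rho> A \<delta> by (auto simp: K_def)
  have L0: "0 \<le> loss_const DIM('a) p s"
    using annulus_const_nonneg[OF s(1)] near_const_nonneg[OF p s(2)] by (simp add: loss_const_def)
  have cube_sub: "cube x0 \<rho> \<subseteq> ball 0 2" using cube_subset_ball[OF \<rho>, of x0] sub \<rho> by (force intro: subsetD[OF sub])
  have J_sub: "{a..T} \<subseteq> {-2<..0}" using T by (auto simp: a_def)
  have cslice: "continuous_on (cube x0 \<rho>) (\<lambda>z. u (z, \<tau>))" if "\<tau> \<in> {a..T}" for \<tau>
    by (rule continuous_on_compose2[OF cont]) (use cube_sub J_sub that in \<open>auto intro!: continuous_intros\<close>)
  have gc: "continuous_on {a..T} g" unfolding g_def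
    by (rule continuous_on_low_average) (use cube_sub J_sub in \<open>auto intro!: continuous_on_subset[OF cont]\<close>)
  have gb: "0 \<le> g \<tau>" "g \<tau> \<le> 1" if "\<tau> \<in> {a..T}" for \<tau>
    unfolding g_def using low_average_bounds[OF cslice[OF that] \<rho>] by auto
  have gi: "g integrable_on {c..d}" if "a \<le> c" "d \<le> T" for c d
    by (rule integrable_continuous_interval, rule continuous_on_subset[OF gc]) (use that in auto)
  have \<Gamma>d: "(\<Gamma> has_real_derivative g \<tau>) (at \<tau> within {a..T})" if "\<tau> \<in> {a..T}" for \<tau>
    unfolding \<Gamma>_def[abs_def] by (rule integral_has_real_derivative[OF gc that])
  have \<Gamma>c: "continuous_on {a..T} \<Gamma>"
    using \<Gamma>d by (meson DERIV_continuous continuous_on_eq_continuous_within)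
  have \<Gamma>0: "0 \<le> \<Gamma> \<tau>" if "\<tau> \<in> {a..T}" for \<tau>
    unfolding \<Gamma>_def using gb that by (intro integral_nonneg gi) auto
  have \<Gamma>1: "\<Gamma> \<tau> \<le> \<tau> - a" if "\<tau> \<in> {a..T}" for \<tau>
  proof -
    have "\<Gamma> \<tau> \<le> integral {a..\<tau>} (\<lambda>_. 1)" unfolding \<Gamma>_def
      using gb that by (intro integral_le gi) auto
    then show ?thesis using that by simp
  qed
  have \<Gamma>2: "h / 2 \<le> \<Gamma> \<tau>" if "\<tau> \<in> {T - h..T}" for \<tau>
  proof -
    have "h / 2 \<le> integral {a..T - h} g" using low by (simp add: a_def g_def)
    also have "\<dots> \<le> integral {a..\<tau>} g"
      using that h0 gb by (intro integral_subset_le gi) (auto simp: a_def)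
    finally show ?thesis by (simp add: \<Gamma>_def)
  qed
  have \<mu>up: "\<mu> \<tau> \<le> A * \<delta>" if "\<tau> \<in> {a..T}" for \<tau>
  proof -
    have "16 * B * \<delta> * \<Gamma> \<tau> \<le> 16 * B * \<delta> * (2 * h)"
      using \<Gamma>1[OF that] that B \<delta> by (intro mult_left_mono) (auto simp: a_def)
    moreover have "0 \<le> 2 * B * \<delta> * (\<tau> - a)" using that B \<delta> by simp
    moreover have "32 * B * h * \<delta> = 16 * B * \<delta> * (2 * h)" by simp
    ultimately have "16 * B * \<delta> * \<Gamma> \<tau> - 2 * B * \<delta> * (\<tau> - a) \<le> 32 * B * h * \<delta>" by linarith
    then have "\<mu> \<tau> \<le> w * (32 * B * h * \<delta>)"
      unfolding \<mu>_def using w0 by (intro mult_left_mono) auto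
    also have "\<dots> = A * \<delta>" using wh by (metis mult.assoc)
    finally show ?thesis .
  qed
  have \<mu>low: "A * \<delta> / 8 \<le> \<mu> \<tau>" if "\<tau> \<in> {T - h..T}" for \<tau>
  proof -
    have "16 * B * \<delta> * (h / 2) \<le> 16 * B * \<delta> * \<Gamma> \<tau>"
      using \<Gamma>2[OF that] B \<delta> by (intro mult_left_mono) auto
    moreover have "2 * B * \<delta> * (\<tau> - a) \<le> 2 * B * \<delta> * (2 * h)"
      using that B \<delta> by (intro mult_left_mono) (auto simp: a_def)
    moreover have "32 * B * h * \<delta> / 8 = 16 * B * \<delta> * (h / 2) - 2 * B * \<delta> * (2 * h)" by simp
    ultimately have "32 * B * h * \<delta> / 8 \<le> 16 * B * \<delta> * \<Gamma> \<tau> - 2 * B * \<delta> * (\<tau> - a)" by linarith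
    then have "w * (32 * B * h * \<delta> / 8) \<le> \<mu> \<tau>"
      unfolding \<mu>_def using w0 by (intro mult_left_mono) auto
    then show ?thesis using wh by (metis mult.assoc times_divide_eq_right)
  qed
  have before: "u (x, \<tau>) \<le> M - A * \<delta> / 16" if \<tau>: "\<tau> \<in> {T - h..<T}" for \<tau>
  proof (rule ccontr)
    assume contra: "\<not> u (x, \<tau>) \<le> M - A * \<delta> / 16"
    define e where "e = u (x, \<tau>) - (M - A * \<delta> / 16)"
    define \<epsilon> where "\<epsilon> = e * (T - \<tau>) / 2"
    have e: "0 < e" using contra by (simp add: e_def)
    have \<epsilon>: "0 < \<epsilon>" using e \<tau> by (simp add: \<epsilon>_def)
    have "X * y / 2 / y = X / 2" if "0 < y" for X y :: real using that by simp
    from this[of "T - \<tau>" e] have \<epsilon>\<tau>: "\<epsilon> / (T - \<tau>) = e / 2" using \<tau> unfolding \<epsilon>_def by (metis atLeastLessThan_iff diff_gt_0_iff_gt)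
    define m where "m t = \<mu> t - \<epsilon> / (T - t)" for t
    define m' where "m' t = w * (16 * B * \<delta> * g t - 2 * B * \<delta>) - \<epsilon> / (T - t)\<^sup>2" for t
    \<comment> \<open>As \<open>m \<le> 0\<close> on \<open>{T'..<T}\<close>, the maximum over the compact set up to time \<open>T'\<close> is not attained at \<open>T'\<close>.\<close>
    define T' where "T' = T - \<epsilon> / (2 * (A * \<delta>))"
    have A\<delta>: "0 < A * \<delta>" using A \<delta> by simp
    have T': "T' < T" using \<epsilon> A\<delta> by (simp add: T'_def)
    have m_le: "m \<theta> < A * \<delta>" if "\<theta> \<in> {a..<T}" for \<theta>
      using \<mu>up[of \<theta>] that \<epsilon> by (simp add: m_def) (smt (verit) divide_pos_pos)
    have m_neg: "m \<theta> \<le> 0" if "\<theta> \<in> {a..<T}" "T' \<le> \<theta>" for \<theta>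
    proof -
      have "T - \<theta> \<le> \<epsilon> / (2 * (A * \<delta>))" using that by (simp add: T'_def)
      also have "\<dots> \<le> \<epsilon> / (A * \<delta>)" using \<epsilon> A\<delta> by (simp add: field_simps)
      finally have "(T - \<theta>) * (A * \<delta>) \<le> \<epsilon>" by (simp only: pos_le_divide_eq[OF A\<delta>])
      moreover have "0 < T - \<theta>" using that by simp
      ultimately have "A * \<delta> \<le> \<epsilon> / (T - \<theta>)" by (metis pos_le_divide_eq mult.commute)
      then show ?thesis using \<mu>up[of \<theta>] that by (simp add: m_def)
    qed
    have ma: "m a < 0" using \<epsilon> h0 by (simp add: m_def \<mu>_def \<Gamma>_def a_def)
    let ?F = "\<lambda>z. u z + m (snd z) - K * (norm (fst z - x0))\<^sup>2"
    have Fx: "M < ?F (x, \<tau>)"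
    proof -
      have "(norm (x - x0))\<^sup>2 \<le> (\<rho> / 4)\<^sup>2"
        using x \<rho> by (intro power_mono) (auto simp: dist_norm norm_minus_commute)
      then have "K * (norm (x - x0))\<^sup>2 \<le> K * (\<rho> / 4)\<^sup>2" using K0 by (intro mult_left_mono) auto
      also have "\<dots> = A * \<delta> / 16" using K\<rho> by (simp add: power_divide)
      finally have "K * (norm (x - x0))\<^sup>2 \<le> A * \<delta> / 16" .
      moreover have "u (x, \<tau>) = M - A * \<delta> / 16 + e" by (simp add: e_def)
      moreover have "A * \<delta> / 8 \<le> \<mu> \<tau>" using \<mu>low[of \<tau>] \<tau> by simp
      moreover have "m \<tau> = \<mu> \<tau> - e / 2" by (simp add: m_def \<epsilon>\<tau>)
      ultimately show ?thesis using e unfolding fst_conv snd_conv by linarith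
    qed
    have Fpos: "0 < m \<theta>" "K * (norm (z - x0))\<^sup>2 < m \<theta>" if "M < ?F (z, \<theta>)" "z \<in> ball x0 (3 * \<rho>)" "\<theta> \<in> {a..T}" for z \<theta>
    proof -
      have "u (z, \<theta>) \<le> M" using top that by (simp add: a_def)
      then show "K * (norm (z - x0))\<^sup>2 < m \<theta>" using that by simp
      moreover have "0 \<le> K * (norm (z - x0))\<^sup>2" using K0 by simp
      ultimately show "0 < m \<theta>" by linarith
    qed
    have x3: "x \<in> ball x0 (3 * \<rho>)" "x \<in> cball x0 \<rho>" using x \<rho> by auto
    have \<tau>a: "\<tau> \<in> {a..<T}" using \<tau> h0 by (auto simp: a_def)
    have "\<tau> < T'" using Fpos(1)[OF Fx x3(1)] m_neg[OF \<tau>a] \<tau>a by fastforce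
    let ?Q = "cball x0 \<rho> \<times> {a..T'}"
    have cb: "cball x0 \<rho> \<subseteq> ball x0 (3 * \<rho>)" using \<rho> by auto
    have Qsub: "?Q \<subseteq> ball 0 2 \<times> {-2<..0}"
      using cb sub J_sub T' by (auto simp del: mem_ball mem_cball)
    have mc: "continuous_on {a..T'} m"
      unfolding m_def \<mu>_def using T' by (auto intro!: continuous_intros continuous_on_subset[OF \<Gamma>c])
    have "continuous_on ?Q (\<lambda>z. m (snd z))"
      by (rule continuous_on_compose2[OF mc]) (auto intro!: continuous_intros)
    then have "continuous_on ?Q ?F"
      by (intro continuous_intros continuous_on_subset[OF cont Qsub])
    moreover have "compact ?Q" by (intro compact_Times compact_cball compact_Icc)
    moreover have xQ: "(x, \<tau>) \<in> ?Q" using x3 \<tau>a \<open>\<tau> < T'\<close> by auto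
    ultimately obtain z1 where z1: "z1 \<in> ?Q" "\<And>z. z \<in> ?Q \<Longrightarrow> ?F z \<le> ?F z1"
      using continuous_attains_sup[of ?Q ?F] by blast
    obtain x1 t1 where z1_eq: "z1 = (x1, t1)" by fastforce
    have x1: "x1 \<in> cball x0 \<rho>" and t1: "t1 \<in> {a..T'}" using z1(1) by (auto simp: z1_eq)
    have max: "?F (z, \<theta>) \<le> ?F (x1, t1)" if "z \<in> cball x0 \<rho>" "\<theta> \<in> {a..T'}" for z \<theta>
      using z1(2)[of "(z, \<theta>)"] that by (simp add: z1_eq)
    have F1: "M < ?F (x1, t1)" using Fx z1(2)[OF xQ] by (simp add: z1_eq)
    have t1': "t1 \<in> {a..<T}" using t1 T' by auto
    have x1b: "x1 \<in> ball x0 (3 * \<rho>)" using x1 cb by blast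
    have pos: "0 < m t1" "K * (norm (x1 - x0))\<^sup>2 < m t1"
      using Fpos[OF F1 x1b] t1' by auto
    have t1_in: "a < t1" "t1 < T'"
      using pos(1) ma m_neg[OF t1'] t1 by (force simp: less_le)+
    have "K * (norm (x1 - x0))\<^sup>2 < K * \<rho>\<^sup>2" using pos(2) m_le[OF t1'] K\<rho> by linarith
    then have "(norm (x1 - x0))\<^sup>2 < \<rho>\<^sup>2" using K0 by simp
    then have x1\<rho>: "x1 \<in> ball x0 \<rho>"
      using \<rho> power2_less_imp_less[of "norm (x1 - x0)" \<rho>] by (simp add: dist_norm norm_minus_commute)
    define C where "C = ?F (x1, t1)"
    have high: "M - A * \<delta> \<le> u (x1, t1)"
    proof -
      have "0 \<le> K * (norm (x1 - x0))\<^sup>2" using K0 by simp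
      then show ?thesis using F1 m_le[OF t1'] by simp
    qed
    have t1I: "t1 \<in> {-2<..0}" using t1' subsetD[OF J_sub, of t1] by simp
    have "\<exists>r1>0. \<forall>z\<in>ball x1 r1. M - A / 2 \<le> u (z, t1)"
    proof -
      have "continuous_on (ball 0 2) (\<lambda>z. u (z, t1))"
        by (rule continuous_on_compose2[OF cont]) (use t1I in \<open>auto intro!: continuous_intros\<close>)
      then have "isCont (\<lambda>z. u (z, t1)) x1"
        using subsetD[OF sub x1b] by (simp add: continuous_on_eq_continuous_at)
      moreover have "M - A / 2 < u (x1, t1)"
      proof -
        have "A * \<delta> \<le> A / 8" using A \<delta> by simp
        then show ?thesis using high A by linarith
      qed
      ultimately have "\<forall>\<^sub>F z in at x1. M - A / 2 < u (z, t1)"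
        by (intro order_tendstoD(1)) (auto simp: isCont_def)
      then obtain r1 where "0 < r1" "\<And>z. z \<noteq> x1 \<Longrightarrow> dist z x1 < r1 \<Longrightarrow> M - A / 2 < u (z, t1)"
        by (auto simp: eventually_at)
      then show ?thesis using \<open>M - A / 2 < u (x1, t1)\<close>
        by (intro exI[of _ r1]) (force simp: dist_commute intro: less_imp_le)
    qed
    then obtain r1 where r1: "0 < r1" "\<And>z. z \<in> ball x1 r1 \<Longrightarrow> M - A / 2 \<le> u (z, t1)" by blast
    define r where "r = Min {r1, \<rho> - dist x0 x1, t1 - a, T' - t1}"
    have r: "0 < r" "r \<le> r1" "r \<le> \<rho> - dist x0 x1" "r \<le> t1 - a" "r \<le> T' - t1"
      using r1 x1\<rho> t1_in by (auto simp: r_def)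
    have ball_r: "ball x1 r \<subseteq> cball x0 \<rho>"
    proof
      fix z assume "z \<in> ball x1 r"
      then show "z \<in> cball x0 \<rho>" using dist_triangle[of x0 z x1] r(3) by simp
    qed
    have time_r: "{t1 - r<..<t1 + r} \<subseteq> {a<..<T'}" using r by auto
    have md: "(m has_real_derivative m' \<theta>) (at \<theta>)" if "\<theta> \<in> {a<..<T'}" for \<theta>
    proof -
      have "(\<Gamma> has_real_derivative g \<theta>) (at \<theta>)"
        using \<Gamma>d[of \<theta>] that T' at_within_Icc_at[of a \<theta> T] by auto
      then show ?thesis unfolding m_def[abs_def] m'_def \<mu>_def[abs_def] using that T'
        by (auto intro!: derivative_eq_intros simp: power2_eq_square)
    qed
    have m'c: "continuous_on {a<..<T'} m'"
      unfolding m'_def using T' by (auto intro!: continuous_intros continuous_on_subset[OF gc])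
    have abv: "u (z, \<theta>) \<le> C + K * (norm (z - x0))\<^sup>2 - m \<theta>" if "z \<in> cball x0 \<rho>" "\<theta> \<in> {a..T'}" for z \<theta>
      using max[OF that] by (simp add: C_def)
    have abv': "u (z, t1) \<le> C + K * (norm (z - x0))\<^sup>2 - m t1" if z: "z \<in> ball x0 (3 * \<rho>)" for z
    proof (cases "z \<in> cball x0 \<rho>")
      case False
      then have "\<rho>\<^sup>2 \<le> (norm (z - x0))\<^sup>2"
        using \<rho> by (intro power_mono) (auto simp: dist_norm norm_minus_commute)
      then have "A * \<delta> \<le> K * (norm (z - x0))\<^sup>2" using K\<rho> K0 by (metis mult_left_mono less_imp_le)
      moreover have "u (z, t1) \<le> M" using top z t1' by (simp add: a_def)
      ultimately show ?thesis using F1 m_le[OF t1'] by (simp add: C_def)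
    qed (use abv t1 in auto)
    have "A powr (p - 1) * \<rho> powr (- (s * p)) *
      (gain_const DIM('a) p s * low_average u M A x0 \<rho> t1 - loss_const DIM('a) p s * \<delta> powr (p - 1))
      \<le> odd_powr p (m' t1)"
    proof (rule barrier_contact[OF p s v \<sigma> u \<rho> A \<delta> sub x1\<rho> r(1), folded K_def, where m = m and C = C])
      show "r \<le> 2 * \<rho>" using r(3) \<rho> zero_le_dist[of x0 x1] by linarith
      show "{t1 - r<..<t1 + r} \<subseteq> {-2<..<0}" using time_r T T' by (auto simp: a_def dest!: subsetD)
      show "continuous_on {t1 - r<..<t1 + r} m'" by (rule continuous_on_subset[OF m'c time_r])
      show "u (x1, t1) = C + K * (norm (x1 - x0))\<^sup>2 - m t1" by (simp add: C_def)
      show "u (z, \<theta>) \<le> C + K * (norm (z - x0))\<^sup>2 - m \<theta>" if "z \<in> ball x1 r" "\<theta> \<in> {t1 - r<..<t1 + r}" for z \<theta>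
      proof (rule abv)
        show "z \<in> cball x0 \<rho>" using that ball_r by blast
        show "\<theta> \<in> {a..T'}" using subsetD[OF time_r that(2)] by simp
      qed
      show "AE z in lebesgue. u (z, t1) \<le> M + A * \<delta> * (norm (z - x0) / \<rho>) powr s"
        using growth t1' by (simp add: a_def)
    qed (use md time_r abv' high r1(2) r(2) cslice t1' in auto)
    moreover have "odd_powr p (m' t1) \<le> odd_powr p (w * (16 * B * \<delta> * g t1 - 2 * B * \<delta>))"
      using \<epsilon> by (intro odd_powr_mono[OF p]) (simp add: m'_def)
    moreover have "\<dots> = w powr (p - 1) * odd_powr p (16 * B * \<delta> * g t1 - 2 * B * \<delta>)"
      by (rule odd_powr_scale[OF w0 p])
    moreover have "w powr (p - 1) = A powr (p - 1) * \<rho> powr (- (s * p))"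
      using A \<rho> p by (simp add: w_def powr_mult powr_powr)
    ultimately have "A powr (p - 1) * \<rho> powr (- (s * p)) * (gain_const DIM('a) p s * g t1 - loss_const DIM('a) p s * \<delta> powr (p - 1))
        \<le> A powr (p - 1) * \<rho> powr (- (s * p)) * odd_powr p (16 * B * \<delta> * g t1 - 2 * B * \<delta>)"
      by (simp add: g_def)
    then have "gain_const DIM('a) p s * g t1 - loss_const DIM('a) p s * \<delta> powr (p - 1)
        \<le> odd_powr p (16 * B * \<delta> * g t1 - 2 * B * \<delta>)"
      using A \<rho> by (simp add: mult_le_cancel_left)
    moreover have "odd_powr p (16 * B * \<delta> * g t1 - 2 * B * \<delta>)
        < gain_const DIM('a) p s * g t1 - loss_const DIM('a) p s * \<delta> powr (p - 1)"
      using barrier_speed[OF p B L0 \<delta>(1) _ small gb, of t1] \<delta> t1' by simp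
    ultimately show False by simp
  qed
  show ?thesis
  proof (cases "t < T")
    case True
    then show ?thesis using before t by simp
  next
    case False
    then have tT: "t = T" using t by simp
    have x2: "x \<in> ball 0 2" using x \<rho> by (intro subsetD[OF sub]) simp
    have "continuous_on {a..T} (\<lambda>\<tau>. u (x, \<tau>))"
      by (rule continuous_on_compose2[OF cont]) (use x2 J_sub in \<open>auto intro!: continuous_intros\<close>)
    then have "((\<lambda>\<tau>. u (x, \<tau>)) \<longlongrightarrow> u (x, T)) (at T within {a..T})"
      using h0 by (auto simp: continuous_on_def a_def)
    then have "((\<lambda>\<tau>. u (x, \<tau>)) \<longlongrightarrow> u (x, T)) (at_left T)"
      using at_within_Icc_at_left[of a T] h0 by (simp add: a_def)
    moreover have "\<forall>\<^sub>F \<tau> in at_left T. u (x, \<tau>) \<le> M - A * \<delta> / 16"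
      using eventually_at_left_real[of "T - h" T] h0 by (auto elim!: eventually_mono intro!: before)
    ultimately show ?thesis unfolding tT by (intro tendsto_upperbound[of _ _ "at_left T"]) auto
  qed
qed

section \<open>Decay of the oscillation\<close>

lemma viscosity_solution_continuous_on:
  assumes "viscosity_solution p s U I v"
  shows "continuous_on (U \<times> I) v"
  unfolding continuous_on_def
proof (intro ballI order_tendstoI)
  fix z a assume z: "z \<in> U \<times> I"
  have usc: "usc_on (U \<times> I) v" and lsc: "lsc_on (U \<times> I) v"
    using assms by (auto simp: viscosity_solution_def viscosity_subsolution_def viscosity_supersolution_def)
  show "\<forall>\<^sub>F w in at z within U \<times> I. a < v w" if "a < v z"
    using lsc[unfolded lsc_on_def, rule_format, OF z that] .
  show "\<forall>\<^sub>F w in at z within U \<times> I. v w < a" if "v z < a"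
    using usc[unfolded usc_on_def, rule_format, OF z that] .
qed

lemma AE_le_imp_le_continuous:
  fixes f :: "'a::euclidean_space \<Rightarrow> real"
  assumes U: "open U" and f: "continuous_on U f" and AE: "AE x in lebesgue. f x \<le> M" and x: "x \<in> U"
  shows "f x \<le> M"
proof (rule ccontr)
  assume "\<not> f x \<le> M"
  then have *: "x \<in> f -` {M<..} \<inter> U" using x by simp
  have "open (f -` {M<..} \<inter> U)" using f U by (intro continuous_on_open_vimage[THEN iffD1, rule_format]) auto
  then obtain r where r: "0 < r" "ball x r \<subseteq> f -` {M<..} \<inter> U" using * open_contains_ball by blast
  have "AE y in lborel. y \<notin> ball x r"
    using AE r(2) unfolding AE_completion_iff by (auto elim!: eventually_mono)
  then have "emeasure lborel (ball x r) = 0"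
    by (simp add: AE_iff_measurable[OF _ refl] ball_def)
  then have "measure lborel (ball x r) = 0" by (simp add: measure_def)
  then show False using content_ball_gt_0_iff[of x r] r(1) by simp
qed

lemma viscosity_solution_bound:
  fixes v :: "'a::euclidean_space \<times> real \<Rightarrow> real"
  assumes v: "viscosity_solution p s (ball 0 2) I v" and z: "z \<in> ball 0 2 \<times> I"
  shows "\<bar>v z\<bar> \<le> enn2real (Linf_norm I v)"
proof -
  obtain x t where xt: "z = (x, t)" "x \<in> ball 0 2" "t \<in> I" using z by auto
  have "v \<in> Linf I" using v by (simp add: viscosity_solution_def viscosity_subsolution_def)
  note AE = Linf_AE_bound[OF this xt(3)]
  have "continuous_on (ball 0 2) (\<lambda>x. \<bar>v (x, t)\<bar>)"
    by (intro continuous_on_rabs continuous_on_compose2[OF viscosity_solution_continuous_on[OF v]])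
       (use xt in \<open>auto intro!: continuous_intros\<close>)
  from AE_le_imp_le_continuous[OF open_ball this AE xt(2)] show ?thesis using xt by simp
qed

text \<open>The weights of \<open>v\<close> and \<open>-v\<close> add up to at least \<open>1\<close> everywhere, so one of the two functions satisfies
  the hypothesis of the decrease of the supremum.\<close>

lemma oscillation_decrease:
  fixes v :: "'a::euclidean_space \<times> real \<Rightarrow> real"
  assumes p: "2 \<le> p" and s: "0 < s" "s < 1"
    and v: "viscosity_solution p s (ball 0 2) {-2<..0} v"
    and \<rho>: "0 < \<rho>" and A: "0 < A" and \<delta>: "0 < \<delta>" "\<delta> \<le> 1/8"
    and B: "1 \<le> B" "loss_const DIM('a) p s < B powr (p - 1)"
    and small: "\<delta> * ((16 * B) powr (p - 1) + loss_const DIM('a) p s) < gain_const DIM('a) p s / 16"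
    and h: "h = \<rho> powr (s * p / (p - 1)) / (32 * B)"
    and T: "T \<le> 0" "-2 < T - 2 * h" and sub: "ball x0 (3 * \<rho>) \<subseteq> ball 0 2"
    and width: "Up - Lo = 2 * A"
    and range: "\<And>x t. x \<in> ball x0 (3 * \<rho>) \<Longrightarrow> t \<in> {T - 2 * h..T} \<Longrightarrow> v (x, t) \<in> {Lo..Up}"
    and growth: "\<And>t. t \<in> {T - 2 * h..T} \<Longrightarrow> AE z in lebesgue.
       v (z, t) \<in> {Lo - A * \<delta> * (norm (z - x0) / \<rho>) powr s..Up + A * \<delta> * (norm (z - x0) / \<rho>) powr s}"
  shows "(\<forall>x\<in>ball x0 (\<rho> / 4). \<forall>t\<in>{T - h..T}. v (x, t) \<le> Up - A * \<delta> / 16) \<or>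
     (\<forall>x\<in>ball x0 (\<rho> / 4). \<forall>t\<in>{T - h..T}. Lo + A * \<delta> / 16 \<le> v (x, t))"
proof -
  have cont: "continuous_on (ball 0 2 \<times> {-2<..0}) v" by (rule viscosity_solution_continuous_on[OF v])
  have cont': "continuous_on (ball 0 2 \<times> {-2<..0}) (\<lambda>z. - v z)" by (intro continuous_on_minus cont)
  have h0: "0 < h" using h \<rho> B by simp
  let ?J = "{T - 2 * h..T - h}"
  let ?g1 = "low_average v Up A x0 \<rho>" and ?g2 = "low_average (\<lambda>z. - v z) (- Lo) A x0 \<rho>"
  have cube_sub: "cube x0 \<rho> \<subseteq> ball 0 2"
    by (intro order_trans[OF cube_subset_ball[OF \<rho>]] order_trans[OF subset_ball sub]) (use \<rho> in simp)
  have J_sub: "?J \<subseteq> {-2<..0}" using T h0 by auto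
  have c1: "continuous_on ?J ?g1" and c2: "continuous_on ?J ?g2"
    by (rule continuous_on_low_average, rule continuous_on_subset[OF cont] continuous_on_subset[OF cont'],
        use cube_sub J_sub in blast)+
  have slice: "continuous_on (cube x0 \<rho>) (\<lambda>z. v (z, t))" if "t \<in> ?J" for t
    by (rule continuous_on_compose2[OF cont]) (use cube_sub J_sub that in \<open>auto intro!: continuous_intros\<close>)
  have "integral ?J (\<lambda>_. 1) \<le> integral ?J (\<lambda>t. ?g1 t + ?g2 t)"
    using low_average_sum[OF slice \<rho>, of _ Up "- Lo" A] width A c1 c2
    by (intro integral_le integrable_continuous_interval continuous_intros) auto
  also have "\<dots> = integral ?J ?g1 + integral ?J ?g2"
    by (intro Henstock_Kurzweil_Integration.integral_add integrable_continuous_interval c1 c2)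
  finally have "h \<le> integral ?J ?g1 + integral ?J ?g2" using h0 by simp
  then consider "h / 2 \<le> integral ?J ?g1" | "h / 2 \<le> integral ?J ?g2" by linarith
  then show ?thesis
  proof cases
    case 1
    have "v (x, t) \<le> Up - A * \<delta> / 16" if "x \<in> ball x0 (\<rho> / 4)" "t \<in> {T - h..T}" for x t
    proof (rule supremum_decrease[OF p s v _ _ cont \<rho> A \<delta> B small h T sub _ _ 1 that, where \<sigma> = 1])
      show "AE z in lebesgue. v (z, t) \<le> Up + A * \<delta> * (norm (z - x0) / \<rho>) powr s"
        if "t \<in> {T - 2 * h..T}" for t using growth[OF that] by eventually_elim simp
    qed (use range in auto)
    then show ?thesis by blast
  next
    case 2
    have "- v (x, t) \<le> - Lo - A * \<delta> / 16" if "x \<in> ball x0 (\<rho> / 4)" "t \<in> {T - h..T}" for x t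
    proof (rule supremum_decrease[OF p s v _ _ cont' \<rho> A \<delta> B small h T sub _ _ 2 that, where \<sigma> = "- 1"])
      show "AE z in lebesgue. - v (z, t) \<le> - Lo + A * \<delta> * (norm (z - x0) / \<rho>) powr s"
        if "t \<in> {T - 2 * h..T}" for t using growth[OF that] by eventually_elim simp
    qed (use range in auto)
    then show ?thesis by force
  qed
qed

text \<open>The growth bound is inherited by the next cylinder, whose radius is \<open>\<nu>\<close> times the previous one: moving one
  end of the range inwards costs \<open>2 A (1 - \<gamma>)\<close>, but in terms of the new radius the old growth term
  carries a factor \<open>l = \<nu>\<^sup>s \<le> 1/4\<close>.\<close>

lemma growth_step:
  fixes \<zeta> :: real
  assumes "0 < A" "0 < \<delta>" "\<delta> \<le> 1/8" "\<gamma> = 1 - \<delta> / 32" "l \<le> 1/4" "1 \<le> \<zeta>"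
  shows "2 * A * (1 - \<gamma>) + A * \<delta> * (l * \<zeta>) \<le> \<gamma> * A * \<delta> * \<zeta>"
proof -
  define X where "X = A * \<delta> * \<zeta>"
  have A\<delta>: "0 < A * \<delta>" using assms by simp
  have "A * \<delta> * (l * \<zeta>) \<le> A * \<delta> * (1 / 4 * \<zeta>)"
    using assms A\<delta> by (intro mult_left_mono mult_right_mono) auto
  then have 1: "A * \<delta> * (l * \<zeta>) \<le> X / 4" by (simp add: X_def)
  have "A * \<delta> * 1 \<le> A * \<delta> * \<zeta>" using assms A\<delta> by (intro mult_left_mono) auto
  then have 2: "A * \<delta> \<le> X" by (simp add: X_def)
  have "0 \<le> X" using 2 A\<delta> by linarith
  then have 3: "1 / 2 * X \<le> \<gamma> * X" using assms by (intro mult_right_mono) auto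
  have 4: "2 * A * (1 - \<gamma>) = A * \<delta> / 16" using assms by simp
  have 5: "\<gamma> * A * \<delta> * \<zeta> = \<gamma> * X" by (simp add: X_def)
  show ?thesis unfolding 4 5 using 1 2 3 \<open>0 \<le> X\<close> by linarith
qed

text \<open>Iteration on the cylinders with radius \<open>3 \<rho> k = \<nu>\<^sup>k\<close> and length \<open>2 H k\<close> that end at \<open>(x0, T)\<close>. The
  ranges on successive cylinders are nested and shrink by the factor \<open>\<gamma>\<close>; the induction also carries
  the growth bound outside the cylinder that the decrease of the oscillation requires.\<close>

lemma oscillation_iteration:
  fixes v :: "'a::euclidean_space \<times> real \<Rightarrow> real"
  assumes p: "2 \<le> p" and s: "0 < s" "s < 1"
    and v: "viscosity_solution p s (ball 0 2) {-2<..0} v"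
    and M: "0 < M" "enn2real (Linf_norm {-2<..0} v) \<le> M"
    and \<delta>: "0 < \<delta>" "\<delta> \<le> 1/8"
    and B: "1 \<le> B" "loss_const DIM('a) p s < B powr (p - 1)"
    and small: "\<delta> * ((16 * B) powr (p - 1) + loss_const DIM('a) p s) < gain_const DIM('a) p s / 16"
    and l: "0 < \<nu>" "\<nu> \<le> 1/12" "\<nu> powr s \<le> 1/4"
    and \<gamma>: "\<gamma> = 1 - \<delta> / 32"
    and x0: "x0 \<in> ball 0 1" and T: "T \<in> {-1<..0}"
    and h: "h = (1/3) powr (s * p / (p - 1)) / (32 * B)"
    and xt: "x \<in> ball x0 (\<nu> ^ k)" "t \<in> {T - 2 * (h * (\<nu> powr (s * p / (p - 1))) ^ k)..T}"
  shows "\<bar>v (x, t) - v (x0, T)\<bar> \<le> 2 * M * \<gamma> ^ k"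
proof -
  define \<beta> where "\<beta> = s * p / (p - 1)"
  define \<rho> where "\<rho> k = \<nu> ^ k / 3" for k :: nat
  define H where "H k = h * (\<nu> powr \<beta>) ^ k" for k :: nat
  define A where "A k = M * \<gamma> ^ k" for k :: nat
  have s\<beta>: "s \<le> \<beta>" using p s by (simp add: \<beta>_def field_simps)
  have h0: "0 < h" using B by (simp add: h)
  have h1: "h \<le> 1 / 32"
  proof -
    have "(1/3) powr (s * p / (p - 1)) \<le> (1::real)" using p s by (intro powr_le1) auto
    then show ?thesis using B unfolding h by (intro frac_le) auto
  qed
  have \<gamma>b: "0 < \<gamma>" "\<gamma> < 1" using \<delta> by (auto simp: \<gamma>)
  have l\<beta>: "\<nu> powr \<beta> \<le> 1/4"
    using powr_mono'[OF s\<beta>, of \<nu>] l by linarith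
  have l\<beta>0: "0 < \<nu> powr \<beta>" using l by simp
  have \<rho>0: "0 < \<rho> k" for k using l by (simp add: \<rho>_def)
  have \<rho>1: "3 * \<rho> k \<le> 1" for k using l by (simp add: \<rho>_def power_le_one)
  have Hb: "0 < H k" "H k \<le> h" for k
  proof -
    have "(\<nu> powr \<beta>) ^ k \<le> 1" using l\<beta> by (intro power_le_one) auto
    then show "0 < H k" "H k \<le> h" using h0 l\<beta>0 by (auto simp: H_def mult_left_le)
  qed
  have H: "H k = \<rho> k powr (s * p / (p - 1)) / (32 * B)" for k
    using l by (simp add: H_def h \<rho>_def \<beta>_def powr_divide powr_power flip: powr_realpow) (simp add: powr_powr mult.commute)
  have A0: "0 < A k" for k using M \<gamma>b by (simp add: A_def)
  have TH: "-2 < T - 2 * H k" for k using Hb(2)[of k] h1 T by simp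
  have sub: "ball x0 (3 * \<rho> k) \<subseteq> ball 0 2" for k
  proof
    fix y assume "y \<in> ball x0 (3 * \<rho> k)"
    then show "y \<in> ball 0 2" using \<rho>1[of k] x0 norm_triangle_ineq2[of y x0] by (simp add: dist_norm norm_minus_commute)
  qed
  have shrink: "3 * \<rho> (Suc k) \<le> \<rho> k / 4" "2 * H (Suc k) \<le> H k" for k
  proof -
    show "3 * \<rho> (Suc k) \<le> \<rho> k / 4" using l mult_right_mono[of \<nu> "1/12" "\<nu> ^ k"] by (simp add: \<rho>_def)
    have "H (Suc k) = \<nu> powr \<beta> * H k" by (simp add: H_def)
    also have "\<dots> \<le> 1/4 * H k" using l\<beta> Hb(1)[of k] by (intro mult_right_mono) auto
    finally show "2 * H (Suc k) \<le> H k" using Hb(1)[of k] by simp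
  qed
  have vL: "v \<in> Linf {-2<..0}" using v by (simp add: viscosity_solution_def viscosity_subsolution_def)
  have vb: "\<bar>v z\<bar> \<le> M" if "z \<in> ball 0 2 \<times> {-2<..0}" for z
    using viscosity_solution_bound[OF v that] M by linarith
  define P where "P k Lo Up \<longleftrightarrow> Up - Lo = 2 * A k
    \<and> (\<forall>x\<in>ball x0 (3 * \<rho> k). \<forall>t\<in>{T - 2 * H k..T}. v (x, t) \<in> {Lo..Up})
    \<and> (\<forall>t\<in>{T - 2 * H k..T}. AE z in lebesgue.
       v (z, t) \<in> {Lo - A k * \<delta> * (norm (z - x0) / \<rho> k) powr s..Up + A k * \<delta> * (norm (z - x0) / \<rho> k) powr s})"
    for k Lo Up
  have "\<exists>Lo Up. P k Lo Up" for k
  proof (induction k)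
    case 0
    have "P 0 (- M) M"
      unfolding P_def
    proof (intro conjI ballI)
      fix y \<tau> assume "y \<in> ball x0 (3 * \<rho> 0)" "\<tau> \<in> {T - 2 * H 0..T}"
      then show "v (y, \<tau>) \<in> {- M..M}" using vb[of "(y, \<tau>)"] subsetD[OF sub] TH[of 0] T by (auto simp: abs_le_iff)
    next
      fix \<tau> assume "\<tau> \<in> {T - 2 * H 0..T}"
      then have "\<tau> \<in> {-2<..0}" using TH[of 0] T by auto
      from Linf_AE_bound[OF vL this]
      show "AE z in lebesgue. v (z, \<tau>) \<in> {- M - A 0 * \<delta> * (norm (z - x0) / \<rho> 0) powr s..M + A 0 * \<delta> * (norm (z - x0) / \<rho> 0) powr s}"
      proof eventually_elim
        case (elim z)
        have "0 \<le> A 0 * \<delta> * (norm (z - x0) / \<rho> 0) powr s" using A0[of 0] \<delta> by simp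
        then show ?case using elim M by (simp add: abs_le_iff)
      qed
    qed (simp add: A_def)
    then show ?case by blast
  next
    case (Suc k)
    then obtain Lo Up where IH: "Up - Lo = 2 * A k"
      "\<And>y \<tau>. y \<in> ball x0 (3 * \<rho> k) \<Longrightarrow> \<tau> \<in> {T - 2 * H k..T} \<Longrightarrow> v (y, \<tau>) \<in> {Lo..Up}"
      "\<And>\<tau>. \<tau> \<in> {T - 2 * H k..T} \<Longrightarrow> AE z in lebesgue.
         v (z, \<tau>) \<in> {Lo - A k * \<delta> * (norm (z - x0) / \<rho> k) powr s..Up + A k * \<delta> * (norm (z - x0) / \<rho> k) powr s}"
      unfolding P_def by blast
    have A': "A (Suc k) = \<gamma> * A k" by (simp add: A_def)
    have imp: "A k * \<delta> / 16 = 2 * A k * (1 - \<gamma>)" by (simp add: \<gamma>)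
    have dicho: "(\<forall>x\<in>ball x0 (\<rho> k / 4). \<forall>t\<in>{T - H k..T}. v (x, t) \<le> Up - A k * \<delta> / 16) \<or>
       (\<forall>x\<in>ball x0 (\<rho> k / 4). \<forall>t\<in>{T - H k..T}. Lo + A k * \<delta> / 16 \<le> v (x, t))"
      using T by (intro oscillation_decrease[OF p s v \<rho>0 A0 \<delta> B small H _ TH sub IH]) auto
    define Lo' where "Lo' = (if \<forall>x\<in>ball x0 (\<rho> k / 4). \<forall>t\<in>{T - H k..T}. v (x, t) \<le> Up - A k * \<delta> / 16
      then Lo else Lo + A k * \<delta> / 16)"
    define Up' where "Up' = (if \<forall>x\<in>ball x0 (\<rho> k / 4). \<forall>t\<in>{T - H k..T}. v (x, t) \<le> Up - A k * \<delta> / 16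
      then Up - A k * \<delta> / 16 else Up)"
    have width: "Up' - Lo' = 2 * A (Suc k)" using IH(1) unfolding Lo'_def Up'_def A' imp by (auto simp: algebra_simps)
    have near: "v (y, \<tau>) \<in> {Lo'..Up'}" if y: "y \<in> ball x0 (3 * \<rho> (Suc k))" and \<tau>: "\<tau> \<in> {T - 2 * H (Suc k)..T}" for y \<tau>
    proof -
      have y4: "y \<in> ball x0 (\<rho> k / 4)" and \<tau>': "\<tau> \<in> {T - H k..T}"
        using y \<tau> shrink[of k] by auto
      then have "v (y, \<tau>) \<in> {Lo..Up}" using \<rho>0[of k] Hb(1)[of k] by (intro IH(2)) auto
      then show ?thesis using dicho y4 \<tau>' by (auto simp: Lo'_def Up'_def)
    qed
    have LU: "Lo' - 2 * A k * (1 - \<gamma>) \<le> Lo" "Up \<le> Up' + 2 * A k * (1 - \<gamma>)"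
      unfolding Lo'_def Up'_def imp using A0[of k] \<gamma>b by auto
    have far: "AE z in lebesgue. v (z, \<tau>) \<in> {Lo' - A (Suc k) * \<delta> * (norm (z - x0) / \<rho> (Suc k)) powr s..
         Up' + A (Suc k) * \<delta> * (norm (z - x0) / \<rho> (Suc k)) powr s}" if \<tau>: "\<tau> \<in> {T - 2 * H (Suc k)..T}" for \<tau>
    proof -
      have "\<tau> \<in> {T - 2 * H k..T}" using \<tau> shrink(2)[of k] Hb(1)[of k] by auto
      from IH(3)[OF this] show ?thesis
      proof eventually_elim
        case (elim z)
        let ?\<zeta> = "(norm (z - x0) / \<rho> (Suc k)) powr s"
        show ?case
        proof (cases "z \<in> ball x0 (3 * \<rho> (Suc k))")
          case True
          moreover have "0 \<le> A (Suc k) * \<delta> * ?\<zeta>" using A0[of "Suc k"] \<delta> by simp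
          ultimately show ?thesis using near[OF True \<tau>] by simp
        next
          case False
          then have "1 \<le> norm (z - x0) / \<rho> (Suc k)"
            using \<rho>0[of "Suc k"] by (simp add: dist_norm norm_minus_commute)
          then have \<zeta>: "1 \<le> ?\<zeta>" using s by (intro ge_one_powr_ge_zero) auto
          have "norm (z - x0) / \<rho> k = \<nu> * (norm (z - x0) / \<rho> (Suc k))"
            using l by (simp add: \<rho>_def)
          then have "(norm (z - x0) / \<rho> k) powr s = \<nu> powr s * ?\<zeta>"
            using l \<rho>0[of "Suc k"] by (simp only:) (subst powr_mult, auto)
          then have "A k * \<delta> * (norm (z - x0) / \<rho> k) powr s + 2 * A k * (1 - \<gamma>) \<le> A (Suc k) * \<delta> * ?\<zeta>"
            using growth_step[OF A0 \<delta> \<gamma> l(3) \<zeta>, of k] by (simp add: A')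
          then show ?thesis using elim LU by simp
        qed
      qed
    qed
    have "P (Suc k) Lo' Up'" unfolding P_def using width near far by blast
    then show ?case by blast
  qed
  then obtain Lo Up where P: "P k Lo Up" by blast
  have "x \<in> ball x0 (3 * \<rho> k)" "t \<in> {T - 2 * H k..T}" using xt by (auto simp: \<rho>_def H_def \<beta>_def)
  then have "v (x, t) \<in> {Lo..Up}" using P by (simp add: P_def)
  moreover have "v (x0, T) \<in> {Lo..Up}" using P \<rho>0[of k] Hb(1)[of k] by (simp add: P_def)
  moreover have "Up - Lo = 2 * M * \<gamma> ^ k" using P by (simp add: P_def A_def)
  ultimately show ?thesis by auto
qed

section \<open>Hoelder continuity\<close>

lemma geometric_decay_imp_holder:
  fixes D d :: real
  assumes d: "0 < d" and c: "0 < c" and l: "0 < l" "l < 1" and \<gamma>: "0 < \<gamma>" "\<gamma> < 1" and K: "0 \<le> K"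
    and D0: "D \<le> K" and D: "\<And>k::nat. d \<le> c * l ^ k \<Longrightarrow> D \<le> K * \<gamma> ^ k"
  shows "D \<le> K / \<gamma> * (d / c) powr (ln \<gamma> / ln l)"
proof -
  define \<alpha> where "\<alpha> = ln \<gamma> / ln l"
  have ln: "ln l < 0" "ln \<gamma> < 0" using l \<gamma> by auto
  have \<alpha>0: "0 < \<alpha>" unfolding \<alpha>_def using ln by (rule divide_neg_neg[rotated])
  have l\<alpha>: "l powr \<alpha> = \<gamma>" using ln l \<gamma> by (simp add: \<alpha>_def powr_def)
  show ?thesis
  proof (cases "d \<le> c")
    case False
    have "1 \<le> (d / c) powr \<alpha>" using False c \<alpha>0 by (intro ge_one_powr_ge_zero) auto
    moreover have "K \<le> K / \<gamma>" using K \<gamma> by (simp add: field_simps mult_left_le)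
    ultimately have "K * 1 \<le> K / \<gamma> * (d / c) powr \<alpha>" using K by (intro mult_mono) auto
    then show ?thesis using D0 by (simp add: \<alpha>_def)
  next
    case True
    obtain i where "l ^ i < d / c" using real_arch_pow_inv[of "d / c" l] d c l by auto
    then have i: "c * l ^ i < d" using c by (simp add: field_simps)
    define j where "j = (LEAST i. c * l ^ i < d)"
    have j: "c * l ^ j < d" unfolding j_def by (rule LeastI[of _ i]) (rule i)
    have "j \<noteq> 0" using j True by (intro notI) simp
    then obtain k where k: "j = Suc k" using not0_implies_Suc by blast
    have "\<not> c * l ^ k < d" using not_less_Least[of k "\<lambda>i. c * l ^ i < d"] k by (simp add: j_def)
    then have "D \<le> K * \<gamma> ^ k" by (intro D) simp
    also have "\<dots> = K / \<gamma> * \<gamma> ^ j" using \<gamma> k by simp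
    also have "\<gamma> ^ j = (l ^ j) powr \<alpha>"
      using l by (simp add: l\<alpha>[symmetric] powr_power flip: powr_realpow) (simp add: powr_powr mult.commute)
    also have "K / \<gamma> * (l ^ j) powr \<alpha> \<le> K / \<gamma> * (d / c) powr \<alpha>"
    proof (rule mult_left_mono)
      have "l ^ j \<le> d / c" using j c by (simp add: field_simps)
      then show "(l ^ j) powr \<alpha> \<le> (d / c) powr \<alpha>" using l \<alpha>0 by (intro powr_mono2) auto
    qed (use K \<gamma> in simp)
    finally show ?thesis by (simp add: \<alpha>_def)
  qed
qed

lemma holder_norm_le:
  assumes "\<And>z. z \<in> S \<Longrightarrow> \<bar>f z\<bar> \<le> M"
    and "\<And>z w. z \<in> S \<Longrightarrow> w \<in> S \<Longrightarrow> z \<noteq> w \<Longrightarrow> \<bar>f z - f w\<bar> \<le> C * M * dist z w powr \<alpha>"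
    and "0 \<le> M" "0 \<le> C"
  shows "holder_norm \<alpha> S f \<le> ennreal (1 + C) * ennreal M"
proof -
  have "(SUP z\<in>S. ennreal \<bar>f z\<bar>) \<le> ennreal M"
    by (rule SUP_least) (use assms(1) in \<open>simp add: ennreal_leI\<close>)
  moreover have "(SUP (z, w)\<in>{(z, w). z \<in> S \<and> w \<in> S \<and> z \<noteq> w}. ennreal (\<bar>f z - f w\<bar> / dist z w powr \<alpha>)) \<le> ennreal (C * M)"
    by (rule SUP_least) (use assms(2) in \<open>auto simp: pos_divide_le_eq intro!: ennreal_leI\<close>)
  ultimately have "holder_norm \<alpha> S f \<le> ennreal M + ennreal (C * M)"
    unfolding holder_norm_def by (rule add_mono)
  also have "\<dots> = ennreal (1 + C) * ennreal M"
    using assms by (simp add: ennreal_plus[symmetric] ennreal_mult[symmetric] distrib_right del: ennreal_plus)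
  finally show ?thesis .
qed

lemma gain_const_pos: "0 < n \<Longrightarrow> 0 < gain_const n p s"
  by (simp add: gain_const_def)

lemma exists_iteration_parameters:
  assumes p: "2 \<le> p" and s: "0 < s" "s < 1" and n: "0 < n"
  obtains B \<delta> \<nu> where "1 \<le> B" "loss_const n p s < B powr (p - 1)" "0 < \<delta>" "\<delta> \<le> 1/8"
    "\<delta> * ((16 * B) powr (p - 1) + loss_const n p s) < gain_const n p s / 16"
    "0 < \<nu>" "\<nu> \<le> 1/12" "\<nu> powr s \<le> 1/4"
proof -
  have L: "0 \<le> loss_const n p s"
    using annulus_const_nonneg[OF s(1)] near_const_nonneg[OF p s(2)] by (simp add: loss_const_def)
  define B where "B = loss_const n p s + 1"
  have B: "1 \<le> B" using L by (simp add: B_def)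
  have "B powr 1 \<le> B powr (p - 1)" using B p by (intro powr_mono) auto
  then have B2: "loss_const n p s < B powr (p - 1)" using B by (simp add: B_def)
  define X where "X = (16 * B) powr (p - 1) + loss_const n p s"
  have X: "0 < X" using L B by (simp add: X_def add_pos_nonneg)
  have G: "0 < gain_const n p s" by (rule gain_const_pos[OF n])
  define \<delta> where "\<delta> = min (1/8) (gain_const n p s / (32 * X))"
  have \<delta>: "0 < \<delta>" "\<delta> \<le> 1/8" using X G by (auto simp: \<delta>_def)
  have "\<delta> * X \<le> gain_const n p s / (32 * X) * X" using X by (intro mult_right_mono) (auto simp: \<delta>_def)
  also have "\<dots> = gain_const n p s / 32" using X by simp
  also have "\<dots> < gain_const n p s / 16" using G by simp
  finally have small: "\<delta> * X < gain_const n p s / 16" .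
  define \<nu> where "\<nu> = min (1/12) ((1/4) powr (1 / s) :: real)"
  have l: "0 < \<nu>" "\<nu> \<le> 1/12" by (auto simp: \<nu>_def)
  have "\<nu> powr s \<le> ((1/4) powr (1 / s)) powr s" using l s by (intro powr_mono2) (auto simp: \<nu>_def)
  also have "\<dots> = 1/4" using s by (simp add: powr_powr)
  finally show thesis using that[of B \<delta> \<nu>] B B2 \<delta> small l by (simp add: X_def)
qed

text \<open>The iteration is centred at whichever of the two points is later. Since the exponent
  \<open>\<beta> = s p / (p - 1)\<close> of the time scale is at most \<open>2\<close>, a point at distance at most \<open>2 h \<nu>\<^bsup>2 k\<^esup>\<close> lies in the
  \<open>k\<close>-th cylinder.\<close>

lemma viscosity_solution_holder_estimate:
  fixes p s :: real
  assumes p: "2 \<le> p" and s: "0 < s" "s < 1"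
  obtains \<alpha> C where "0 < \<alpha>" "\<alpha> < 1" "0 \<le> C"
    "\<And>(v :: 'a::euclidean_space \<times> real \<Rightarrow> real) z w.
       viscosity_solution p s (ball 0 2) {-2<..0} v \<Longrightarrow>
       z \<in> ball 0 1 \<times> {-1<..0} \<Longrightarrow> w \<in> ball 0 1 \<times> {-1<..0} \<Longrightarrow> z \<noteq> w \<Longrightarrow>
       \<bar>v z - v w\<bar> \<le> C * enn2real (Linf_norm {-2<..0} v) * dist z w powr \<alpha>"
proof -
  obtain B \<delta> \<nu> where B: "1 \<le> B" "loss_const DIM('a) p s < B powr (p - 1)" and \<delta>: "0 < \<delta>" "\<delta> \<le> 1/8"
    and small: "\<delta> * ((16 * B) powr (p - 1) + loss_const DIM('a) p s) < gain_const DIM('a) p s / 16"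
    and l: "0 < \<nu>" "\<nu> \<le> 1/12" "\<nu> powr s \<le> 1/4"
    using exists_iteration_parameters[OF p s, of "DIM('a)"] by auto
  define \<gamma> where "\<gamma> = 1 - \<delta> / 32"
  define \<beta> where "\<beta> = s * p / (p - 1)"
  define h where "h = (1/3) powr \<beta> / (32 * B)"
  define \<alpha> where "\<alpha> = ln \<gamma> / ln (\<nu>\<^sup>2)"
  define C where "C = 2 / \<gamma> * (1 / (2 * h)) powr \<alpha>"
  have \<gamma>: "1 / 2 < \<gamma>" "\<gamma> < 1" using \<delta> by (auto simp: \<gamma>_def)
  have l2: "0 < \<nu>\<^sup>2" "\<nu>\<^sup>2 < 1" "\<nu>\<^sup>2 < \<gamma>"
  proof -
    have "\<nu>\<^sup>2 \<le> (1/12)\<^sup>2" using l by (intro power_mono) auto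
    then show "0 < \<nu>\<^sup>2" "\<nu>\<^sup>2 < 1" "\<nu>\<^sup>2 < \<gamma>" using \<gamma> l by (auto simp: power_divide)
  qed
  have ln: "ln (\<nu>\<^sup>2) < ln \<gamma>" "ln \<gamma> < 0"
    using l2 \<gamma> ln_less_cancel_iff[of "\<nu>\<^sup>2" \<gamma>] ln_less_zero[of \<gamma>] by linarith+
  have \<alpha>: "0 < \<alpha>" "\<alpha> < 1" using ln by (auto simp: \<alpha>_def divide_neg_neg neg_divide_less_eq)
  have h0: "0 < h" using B by (simp add: h_def)
  have \<beta>2: "0 < \<beta>" "\<beta> \<le> 2"
  proof -
    show "0 < \<beta>" using p s by (simp add: \<beta>_def)
    define X where "X = s * p"
    have "X < p" unfolding X_def by (rule sp_less_p[OF p s(2)])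
    then have "X \<le> 2 * (p - 1)" using p by argo
    then show "\<beta> \<le> 2" unfolding \<beta>_def X_def[symmetric] using p by (simp add: pos_divide_le_eq)
  qed
  have h1: "2 * h < 1"
  proof -
    have "(1/3) powr \<beta> \<le> (1::real)" using \<beta>2 by (intro powr_le1) auto
    then show ?thesis using B unfolding h_def by simp
  qed
  have C: "0 \<le> C" using \<gamma> by (simp add: C_def)
  have est: "\<bar>v z - v w\<bar> \<le> C * enn2real (Linf_norm {-2<..0} v) * dist z w powr \<alpha>"
    if v: "viscosity_solution p s (ball 0 2) {-2<..0} v" and z: "z \<in> ball 0 1 \<times> {-1<..0}"
      and w: "w \<in> ball 0 1 \<times> {-1<..0}" and zw: "z \<noteq> w" and le: "snd z \<le> snd w" for v :: "'a \<times> real \<Rightarrow> real" and z w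
  proof -
    define M where "M = enn2real (Linf_norm {-2<..0} v)"
    obtain x t y T where eq: "z = (x, t)" "w = (y, T)" by fastforce
    have "z \<in> ball 0 2 \<times> {-2<..0}" "w \<in> ball 0 2 \<times> {-2<..0}" using z w by auto
    then have b: "\<bar>v z\<bar> \<le> M" "\<bar>v w\<bar> \<le> M"
      using viscosity_solution_bound[OF v] by (auto simp: M_def)
    show ?thesis
    proof (cases "M = 0")
      \<comment> \<open>The iteration needs a range of positive width.\<close>
      case True
      then show ?thesis using b by (simp add: M_def)
    next
      case False
      then have M: "0 < M" using b by linarith
      have dx: "dist x y \<le> dist z w" and dt: "T - t \<le> dist z w"
        using dist_fst_le[of z w] dist_snd_le[of z w] by (auto simp: eq dist_real_def)
      have "\<bar>v z - v w\<bar> \<le> 2 * M / \<gamma> * (dist z w / (2 * h)) powr (ln \<gamma> / ln (\<nu>\<^sup>2))"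
      proof (rule geometric_decay_imp_holder)
        fix k :: nat assume k: "dist z w \<le> 2 * h * (\<nu>\<^sup>2) ^ k"
        have "dist x y < \<nu> ^ k"
        proof -
          have "\<nu>\<^sup>2 \<le> \<nu>" using l by (simp add: power2_eq_square mult_left_le)
          then have "(\<nu>\<^sup>2) ^ k \<le> \<nu> ^ k" by (intro power_mono) auto
          then have "2 * h * (\<nu>\<^sup>2) ^ k \<le> 2 * h * \<nu> ^ k" using h0 by (intro mult_left_mono) auto
          also have "\<dots> < 1 * \<nu> ^ k" using h1 l by (intro mult_strict_right_mono) auto
          finally show ?thesis using k dx by simp
        qed
        moreover have "T - t \<le> 2 * (h * (\<nu> powr \<beta>) ^ k)"
        proof -
          have "\<nu>\<^sup>2 \<le> \<nu> powr \<beta>" using powr_mono'[OF \<beta>2(2), of \<nu>] l by simp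
          then have "(\<nu>\<^sup>2) ^ k \<le> (\<nu> powr \<beta>) ^ k" by (intro power_mono) auto
          then have "2 * h * (\<nu>\<^sup>2) ^ k \<le> 2 * h * (\<nu> powr \<beta>) ^ k" using h0 by (intro mult_left_mono) auto
          then show ?thesis using k dt by simp
        qed
        ultimately show "\<bar>v z - v w\<bar> \<le> 2 * M * \<gamma> ^ k"
          unfolding eq using w z le
          by (intro oscillation_iteration[OF p s v M _ \<delta> B small l \<gamma>_def, of y T h x k t])
             (auto simp: eq M_def h_def \<beta>_def dist_commute)
      qed (use zw h0 l2 \<gamma> M b in auto)
      also have "\<dots> = C * M * dist z w powr \<alpha>"
        using h0 unfolding \<alpha>_def[symmetric] C_def by (simp add: powr_divide)
      finally show ?thesis by (simp add: M_def)
    qed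
  qed
  show thesis
  proof (rule that[OF \<alpha> C])
    fix v :: "'a \<times> real \<Rightarrow> real" and z w :: "'a \<times> real"
    assume *: "viscosity_solution p s (ball 0 2) {-2<..0} v" "z \<in> ball 0 1 \<times> {-1<..0}" "w \<in> ball 0 1 \<times> {-1<..0}" "z \<noteq> w"
    show "\<bar>v z - v w\<bar> \<le> C * enn2real (Linf_norm {-2<..0} v) * dist z w powr \<alpha>"
      using est[OF *] est[OF *(1) *(3) *(2)] *(4) by (cases "snd z \<le> snd w") (auto simp: dist_commute abs_minus_commute)
  qed
qed

theorem theorem1p1:
  fixes p s :: real
  assumes "p \<ge> 2" and "0 < s" and "s < 1"
  shows "\<exists>\<alpha> C. 0 < \<alpha> \<and> \<alpha> < 1 \<and> 0 \<le> C \<and>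
    (\<forall>v :: (real ^ 'n) \<times> real \<Rightarrow> real.
       viscosity_solution p s (ball 0 2) {-2<..0} v \<longrightarrow>
         holder_norm \<alpha> (ball 0 1 \<times> {-1<..0}) v < \<infinity> \<and>
         holder_norm \<alpha> (ball 0 1 \<times> {-1<..0}) v \<le> ennreal C * Linf_norm {-2<..0} v)"
proof -
  obtain \<alpha> C where \<alpha>: "0 < \<alpha>" "\<alpha> < 1" and C: "0 \<le> C"
    and est: "\<And>(v :: (real ^ 'n) \<times> real \<Rightarrow> real) z w.
       viscosity_solution p s (ball 0 2) {-2<..0} v \<Longrightarrow>
       z \<in> ball 0 1 \<times> {-1<..0} \<Longrightarrow> w \<in> ball 0 1 \<times> {-1<..0} \<Longrightarrow> z \<noteq> w \<Longrightarrow>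
       \<bar>v z - v w\<bar> \<le> C * enn2real (Linf_norm {-2<..0} v) * dist z w powr \<alpha>"
    using viscosity_solution_holder_estimate[OF assms, where ?'a = "real ^ 'n"] by metis
  have "holder_norm \<alpha> (ball 0 1 \<times> {-1<..0}) v < \<infinity> \<and>
      holder_norm \<alpha> (ball 0 1 \<times> {-1<..0}) v \<le> ennreal (1 + C) * Linf_norm {-2<..0} v"
    if v: "viscosity_solution p s (ball 0 2) {-2<..0} v" for v :: "(real ^ 'n) \<times> real \<Rightarrow> real"
  proof -
    let ?M = "enn2real (Linf_norm {-2<..0} v)"
    have fin: "Linf_norm {-2<..0} v < \<infinity>"
      using v by (simp add: viscosity_solution_def viscosity_subsolution_def Linf_def)
    then have M: "ennreal ?M = Linf_norm {-2<..0} v" by simp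
    have "holder_norm \<alpha> (ball 0 1 \<times> {-1<..0}) v \<le> ennreal (1 + C) * ennreal ?M"
    proof (rule holder_norm_le)
      show "\<bar>v z\<bar> \<le> ?M" if "z \<in> ball 0 1 \<times> {-1<..0}" for z
        using that by (intro viscosity_solution_bound[OF v]) auto
    qed (use est[OF v] C in auto)
    moreover have "ennreal (1 + C) * ennreal ?M < \<infinity>" by (simp add: ennreal_mult_less_top)
    ultimately show ?thesis unfolding M by (auto intro: le_less_trans)
  qed
  then show ?thesis using \<alpha> C by (intro exI[of _ \<alpha>] exI[of _ "1 + C"]) auto
qed

end
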